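(* In the setting below, the total kinetic energy contained in the four corner regions, $$\sum_{i=1}^4\int_{D_i}\bigl(|u|^2+|v|^2+|w|^2\bigr)\,dx\,dz,$$ does not depend on $t$. Setting: $D=\{(x,z):\ -1<z<0,\ -1<x<z+1\}$; for $\lambda\in(\tfrac12,\tfrac45)$, $a=\sqrt{\lambda/(1-\lambda)}$, $P(\lambda)=\{(x,z):\ a-3+\tfrac1a<z-\tfrac{x}{a}<1-a+\tfrac1a,\ 1-a-\tfrac1a<z+\tfrac{x}{a}<a-1-\tfrac1a\}$, $\chi(x,z,\lambda)$ the indicator of $P(\lambda)$ in $D$; $\tfrac12<\lambda_*<\lambda_{**}<\tfrac45$, $\sigma_0\in C^1[\tfrac12,\tfrac45]$, $\psi(x,z,t)=\int_{\lambda_*}^{\lambda_{**}}\cos(\sqrt\lambda\,t)\sigma_0(\lambda)\chi(x,z,\lambda)\,d\lambda$, $u=-\psi_z$, $v=\int_0^t\psi_z(x,z,s)\,ds$, $w=\psi_x$. For $\mu\in[\lambda_*,\lambda_{**}]$ let $CA(\mu),AB(\mu),BD(\mu),DC(\mu)$ be the sides of $\overline{P(\mu)}$ on the lines $z=1+\frac xa+\frac1a-a$, $z=1-\frac xa-\frac1a-a$, $z=\frac xa+\frac1a+a-3$, $z=-\frac xa-\frac1a+a-1$ ($a=a(\mu)$), $\Sigma_{CA}=\bigcup_{\mu\in[\lambda_*,\lambda_{**}]}CA(\mu)$ and similarly $\Sigma_{AB},\Sigma_{BD},\Sigma_{DC}$; and $D_1,D_2,D_3,D_4$ are the interiors of $\Sigma_{CA}\cap\Sigma_{DC}$,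 $\Sigma_{CA}\cap\Sigma_{AB}$, $\Sigma_{AB}\cap\Sigma_{BD}$, $\Sigma_{BD}\cap\Sigma_{DC}$.
   Context: $(u,v,w)$ is the velocity field of an inertial wave, i.e. a solution of the linearized rotating-fluid system $u_t=v-p_x$, $v_t=-u$, $w_t=-p_z$, $u_x+w_z=0$ in $D$ with $un_1+wn_3=0$ on $\partial D$; for such solutions the total kinetic energy $\int_D(|u|^2+|v|^2+|w|^2)\,dx\,dz$ is conserved. $D_1,\dots,D_4$ are the corner regions of the decomposition of $D$ by $\partial P(\lambda_* )$ and $\partial P(\lambda_{**})$. *)

theory Defs
  imports "HOL-Analysis.Analysis"
begin

definition domD :: "(real \<times> real) set" where
  "domD = {(x, z). -1 < z \<and> z < 0 \<and> -1 < x \<and> x < z + 1}"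

definition aa :: "real \<Rightarrow> real" where
  "aa l = sqrt (l / (1 - l))"

definition PP :: "real \<Rightarrow> (real \<times> real) set" where
  "PP l = {(x, z). aa l - 3 + 1 / aa l < z - x / aa l \<and> z - x / aa l < 1 - aa l + 1 / aa l
                 \<and> 1 - aa l - 1 / aa l < z + x / aa l \<and> z + x / aa l < aa l - 1 - 1 / aa l}"

definition chi :: "real \<Rightarrow> real \<Rightarrow> real \<Rightarrow> real" where
  "chi x z l = indicator (PP l \<inter> domD) (x, z)"

definition psi :: "real \<Rightarrow> real \<Rightarrow> (real \<Rightarrow> real) \<Rightarrow> real \<Rightarrow> real \<Rightarrow> real \<Rightarrow> real" where
  "psi ls lss \<sigma>0 x z t = integral {ls..lss} (\<lambda>l. cos (sqrt l * t) * \<sigma>0 l * chi x z l)"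

definition psi_z :: "real \<Rightarrow> real \<Rightarrow> (real \<Rightarrow> real) \<Rightarrow> real \<Rightarrow> real \<Rightarrow> real \<Rightarrow> real" where
  "psi_z ls lss \<sigma>0 x z t = deriv (\<lambda>z'. psi ls lss \<sigma>0 x z' t) z"

definition psi_x :: "real \<Rightarrow> real \<Rightarrow> (real \<Rightarrow> real) \<Rightarrow> real \<Rightarrow> real \<Rightarrow> real \<Rightarrow> real" where
  "psi_x ls lss \<sigma>0 x z t = deriv (\<lambda>x'. psi ls lss \<sigma>0 x' z t) x"

definition uu :: "real \<Rightarrow> real \<Rightarrow> (real \<Rightarrow> real) \<Rightarrow> real \<Rightarrow> real \<Rightarrow> real \<Rightarrow> real" where
  "uu ls lss \<sigma>0 x z t = - psi_z ls lss \<sigma>0 x z t"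

definition vv :: "real \<Rightarrow> real \<Rightarrow> (real \<Rightarrow> real) \<Rightarrow> real \<Rightarrow> real \<Rightarrow> real \<Rightarrow> real" where
  "vv ls lss \<sigma>0 x z t =
     (if 0 \<le> t then integral {0..t} (\<lambda>s. psi_z ls lss \<sigma>0 x z s)
      else - integral {t..0} (\<lambda>s. psi_z ls lss \<sigma>0 x z s))"

definition ww :: "real \<Rightarrow> real \<Rightarrow> (real \<Rightarrow> real) \<Rightarrow> real \<Rightarrow> real \<Rightarrow> real \<Rightarrow> real" where
  "ww ls lss \<sigma>0 x z t = psi_x ls lss \<sigma>0 x z t"

definition sideCA :: "real \<Rightarrow> (real \<times> real) set" where
  "sideCA m = closure (PP m) \<inter> {(x, z). z = 1 + x / aa m + 1 / aa m - aa m}"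
definition sideAB :: "real \<Rightarrow> (real \<times> real) set" where
  "sideAB m = closure (PP m) \<inter> {(x, z). z = 1 - x / aa m - 1 / aa m - aa m}"
definition sideBD :: "real \<Rightarrow> (real \<times> real) set" where
  "sideBD m = closure (PP m) \<inter> {(x, z). z = x / aa m + 1 / aa m + aa m - 3}"
definition sideDC :: "real \<Rightarrow> (real \<times> real) set" where
  "sideDC m = closure (PP m) \<inter> {(x, z). z = - x / aa m - 1 / aa m + aa m - 1}"

definition SigmaCA :: "real \<Rightarrow> real \<Rightarrow> (real \<times> real) set" where
  "SigmaCA ls lss = (\<Union>m\<in>{ls..lss}. sideCA m)"
definition SigmaAB :: "real \<Rightarrow> real \<Rightarrow> (real \<times> real) set" where
  "SigmaAB ls lss = (\<Union>m\<in>{ls..lss}. sideAB m)"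
definition SigmaBD :: "real \<Rightarrow> real \<Rightarrow> (real \<times> real) set" where
  "SigmaBD ls lss = (\<Union>m\<in>{ls..lss}. sideBD m)"
definition SigmaDC :: "real \<Rightarrow> real \<Rightarrow> (real \<times> real) set" where
  "SigmaDC ls lss = (\<Union>m\<in>{ls..lss}. sideDC m)"

definition corner1 :: "real \<Rightarrow> real \<Rightarrow> (real \<times> real) set" where
  "corner1 ls lss = interior (SigmaCA ls lss \<inter> SigmaDC ls lss)"
definition corner2 :: "real \<Rightarrow> real \<Rightarrow> (real \<times> real) set" where
  "corner2 ls lss = interior (SigmaCA ls lss \<inter> SigmaAB ls lss)"
definition corner3 :: "real \<Rightarrow> real \<Rightarrow> (real \<times> real) set" where
  "corner3 ls lss = interior (SigmaAB ls lss \<inter> SigmaBD ls lss)"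
definition corner4 :: "real \<Rightarrow> real \<Rightarrow> (real \<times> real) set" where
  "corner4 ls lss = interior (SigmaBD ls lss \<inter> SigmaDC ls lss)"

definition edens :: "real \<Rightarrow> real \<Rightarrow> (real \<Rightarrow> real) \<Rightarrow> real \<Rightarrow> real \<times> real \<Rightarrow> real" where
  "edens ls lss \<sigma>0 t p = (case p of (x, z) \<Rightarrow>
      (uu ls lss \<sigma>0 x z t)\<^sup>2 + (vv ls lss \<sigma>0 x z t)\<^sup>2 + (ww ls lss \<sigma>0 x z t)\<^sup>2)"

definition corner_energy :: "real \<Rightarrow> real \<Rightarrow> (real \<Rightarrow> real) \<Rightarrow> real \<Rightarrow> real" where
  "corner_energy ls lss \<sigma>0 t =
     integral (corner1 ls lss) (edens ls lss \<sigma>0 t)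
   + integral (corner2 ls lss) (edens ls lss \<sigma>0 t)
   + integral (corner3 ls lss) (edens ls lss \<sigma>0 t)
   + integral (corner4 ls lss) (edens ls lss \<sigma>0 t)"

end

theory Submission
  imports Defs
begin

text \<open>
  Through each point of a corner region pass one side with parameter \<open>a\<close> from the family of slope
  \<open>1/a\<close> and one side with parameter \<open>b < a\<close> from the family of slope \<open>-1/b\<close>, and \<open>\<psi>\<close> is the
  integral over the \<open>\<lambda>\<close> with \<open>b < a(\<lambda>) < a\<close>. Hence \<open>u, v, w\<close> are superpositions of two waves, one for
  each family. The energy density of a single wave is constant in time because
  \<open>1 + 1/a\<^sup>2 = 1/\<lambda>\<close>. In the coordinates \<open>(a, b)\<close> every corner is the triangle
  \<open>a(\<lambda>\<^sub>*) < b < a < a(\<lambda>\<^sub>*\<^sub>*)\<close>, and the interaction term, multiplied by the Jacobian, is the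
  same function of \<open>(a, b, t)\<close> in each of them up to a sign. The signs are \<open>-, +, -, +\<close>, so the
  interactions cancel in the sum.
\<close>

section \<open>Change of variables in the plane\<close>

text \<open>The change of variables formula with a determinant lives on \<open>real^2\<close>; this
  map and \<open>vec_of_pair\<close> are mutually inverse linear isometries that carry it over to
  pairs.\<close>

definition pair_of_vec :: "real^2 \<Rightarrow> real \<times> real" where
  "pair_of_vec v = (v $ 1, v $ 2)"

definition vec_of_pair :: "real \<times> real \<Rightarrow> real^2" where
  "vec_of_pair p = vector [fst p, snd p]"

lemma vec_of_pair_nth [simp]: "vec_of_pair p $ 1 = fst p" "vec_of_pair p $ 2 = snd p"
  by (simp_all add: vec_of_pair_def)

lemma pair_of_vec_inverse [simp]: "vec_of_pair (pair_of_vec v) = v"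
  by (simp add: vec_eq_iff forall_2 pair_of_vec_def)

lemma vec_of_pair_inverse [simp]: "pair_of_vec (vec_of_pair p) = p"
  by (simp add: pair_of_vec_def)

lemma norm_vec_of_pair [simp]: "norm (vec_of_pair p) = norm p"
  by (simp add: norm_vec_def L2_set_def sum_2 norm_prod_def)

lemma bounded_linear_pair_of_vec: "bounded_linear pair_of_vec"
  unfolding pair_of_vec_def by (intro bounded_linear_Pair bounded_linear_vec_nth)

lemma bounded_linear_vec_of_pair: "bounded_linear vec_of_pair"
  by (rule bounded_linear_intro[where K = 1])
     (auto simp: vec_eq_iff forall_2)

lemma vec_of_pair_cbox: "vec_of_pair ` cbox u v = cbox (vec_of_pair u) (vec_of_pair v)"
proof (intro equalityI subsetI)
  fix w assume "w \<in> cbox (vec_of_pair u) (vec_of_pair v)"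
  then have "pair_of_vec w \<in> cbox u v"
    by (cases u; cases v) (auto simp: mem_box_cart forall_2 pair_of_vec_def)
  then show "w \<in> vec_of_pair ` cbox u v"
    by (metis imageI pair_of_vec_inverse)
qed (cases u; cases v; auto simp: mem_box_cart forall_2)

lemma pair_of_vec_cbox: "pair_of_vec ` cbox u v = cbox (pair_of_vec u) (pair_of_vec v)"
  using vec_of_pair_cbox[of "pair_of_vec u" "pair_of_vec v"]
  by (metis (no_types, lifting) image_cong image_image image_ident pair_of_vec_inverse vec_of_pair_inverse)

lemma content_vec_of_pair: "measure lborel (vec_of_pair ` cbox u v) = measure lborel (cbox u v)"
proof (cases u; cases v)
  fix a b c d assume [simp]: "u = (a, b)" "v = (c, d)"
  have e: "(\<exists>i::2. P i) \<longleftrightarrow> P 1 \<or> P 2" for P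
    by (metis exhaust_2)
  show ?thesis
    unfolding vec_of_pair_cbox
    by (simp add: content_cbox_if_cart content_Pair UNIV_2 interval_eq_empty_cart e)
qed

text \<open>Both maps send boxes to boxes of equal content, so the scaling factor in
  \<open>has_integral_twiddle\<close> is 1.\<close>

lemma has_integral_pair_of_vec_cbox:
  assumes "(f has_integral i) (cbox u v)"
  shows "((\<lambda>x. f (pair_of_vec x)) has_integral i) (vec_of_pair ` cbox u v)"
proof -
  have "((\<lambda>x. f (pair_of_vec x)) has_integral (1 / 1) *\<^sub>R i) (vec_of_pair ` cbox u v)"
  proof (rule has_integral_twiddle[OF _ _ _ _ _ _ _ assms])
    show "\<exists>w z. pair_of_vec ` cbox u v = cbox w z" for u v
      using pair_of_vec_cbox by blast
    show "\<exists>w z. vec_of_pair ` cbox u v = cbox w z" for u v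
      using vec_of_pair_cbox by blast
    show "measure lborel (pair_of_vec ` cbox u v) = 1 * measure lborel (cbox u v)" for u v
      using content_vec_of_pair[of "pair_of_vec u" "pair_of_vec v"]
      by (simp add: vec_of_pair_cbox pair_of_vec_cbox)
    show "isCont pair_of_vec x" for x
      by (simp add: bounded_linear_pair_of_vec linear_continuous_at)
  qed auto
  then show ?thesis by simp
qed

lemma has_integral_vec_of_pair_cbox:
  assumes "(f has_integral i) (cbox u v)"
  shows "((\<lambda>x. f (vec_of_pair x)) has_integral i) (pair_of_vec ` cbox u v)"
proof -
  have "((\<lambda>x. f (vec_of_pair x)) has_integral (1 / 1) *\<^sub>R i) (pair_of_vec ` cbox u v)"
  proof (rule has_integral_twiddle[OF _ _ _ _ _ _ _ assms])
    show "\<exists>w z. pair_of_vec ` cbox u v = cbox w z" for u v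
      using pair_of_vec_cbox by blast
    show "\<exists>w z. vec_of_pair ` cbox u v = cbox w z" for u v
      using vec_of_pair_cbox by blast
    show "measure lborel (vec_of_pair ` cbox u v) = 1 * measure lborel (cbox u v)" for u v
      by (simp add: content_vec_of_pair)
    show "isCont vec_of_pair x" for x
      by (simp add: bounded_linear_vec_of_pair linear_continuous_at)
  qed auto
  then show ?thesis by simp
qed

lemma has_integral_pair_of_vec_cbox_iff:
  "((\<lambda>x. f (pair_of_vec x)) has_integral i) (cbox u v)
     \<longleftrightarrow> (f has_integral i) (cbox (pair_of_vec u) (pair_of_vec v))"
  using has_integral_pair_of_vec_cbox[of f i "pair_of_vec u" "pair_of_vec v"]
    has_integral_vec_of_pair_cbox[of "\<lambda>x. f (pair_of_vec x)" i u v]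
  by (auto simp: vec_of_pair_cbox pair_of_vec_cbox)

text \<open>By \<open>has_integral'\<close>, an integral over any set is a limit over boxes
  containing large balls. Integrals over boxes correspond by the box case, and balls about 0
  correspond because the maps preserve norms.\<close>

lemma has_integral_pair_of_vec_iff:
  fixes f :: "real \<times> real \<Rightarrow> 'a::banach"
  shows "((\<lambda>x. f (pair_of_vec x)) has_integral i) (vec_of_pair ` S) \<longleftrightarrow> (f has_integral i) S"
proof -
  have box: "((\<lambda>x. if x \<in> vec_of_pair ` S then f (pair_of_vec x) else 0) has_integral y) (cbox u v)
      \<longleftrightarrow> ((\<lambda>x. if x \<in> S then f x else 0) has_integral y) (cbox (pair_of_vec u) (pair_of_vec v))"
    for u v y
  proof -
    have "(\<lambda>x. if x \<in> vec_of_pair ` S then f (pair_of_vec x) else 0)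
        = (\<lambda>x. if pair_of_vec x \<in> S then f (pair_of_vec x) else 0)"
      by (force simp: image_iff)
    then show ?thesis
      using has_integral_pair_of_vec_cbox_iff[of "\<lambda>x. if x \<in> S then f x else 0"] by simp
  qed
  have n: "norm (pair_of_vec x) = norm x" for x
    by (metis norm_vec_of_pair pair_of_vec_inverse)
  have sub: "ball 0 B \<subseteq> cbox u v \<longleftrightarrow> ball 0 B \<subseteq> cbox (pair_of_vec u) (pair_of_vec v)" for B u v
  proof -
    have b: "pair_of_vec ` ball 0 B = ball 0 B"
    proof (intro equalityI subsetI)
      fix p :: "real \<times> real" assume "p \<in> ball 0 B"
      then have "vec_of_pair p \<in> ball 0 B" by simp
      then show "p \<in> pair_of_vec ` ball 0 B" by (metis imageI vec_of_pair_inverse)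
    qed (auto simp: n)
    have "inj pair_of_vec" by (metis injI pair_of_vec_inverse)
    then show ?thesis
      by (metis b inj_image_subset_iff pair_of_vec_cbox)
  qed
  have all: "(\<forall>u v. P (pair_of_vec u) (pair_of_vec v)) \<longleftrightarrow> (\<forall>u v. P u v)"
    for P :: "real \<times> real \<Rightarrow> real \<times> real \<Rightarrow> bool"
    by (metis vec_of_pair_inverse)
  show ?thesis
    unfolding has_integral'[where S = "vec_of_pair ` S"] has_integral'[where S = S]
    unfolding box sub
    using all[where P = "\<lambda>u v. ball 0 _ \<subseteq> cbox u v \<longrightarrow>
      (\<exists>z. ((\<lambda>x. if x \<in> S then f x else 0) has_integral z) (cbox u v) \<and> norm (z - i) < _)"]
    by simp
qed

lemma integrable_pair_of_vec_iff:
  fixes f :: "real \<times> real \<Rightarrow> 'a::banach"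
  shows "(\<lambda>x. f (pair_of_vec x)) integrable_on (vec_of_pair ` S) \<longleftrightarrow> f integrable_on S"
  by (simp add: integrable_on_def has_integral_pair_of_vec_iff)

lemma integral_pair_of_vec:
  fixes f :: "real \<times> real \<Rightarrow> 'a::banach"
  shows "integral (vec_of_pair ` S) (\<lambda>x. f (pair_of_vec x)) = integral S f"
  by (simp add: integral_def integrable_on_def has_integral_pair_of_vec_iff)

text \<open>Conjugating \<open>g\<close> by the isometries reduces this to \<open>real^2\<close>;
  \<open>J\<close> is the determinant of the 2 by 2 matrix of \<open>g' x\<close> written
  out.\<close>

theorem integral_change_of_variables_prod:
  fixes f :: "real \<times> real \<Rightarrow> real" and g :: "real \<times> real \<Rightarrow> real \<times> real"
  assumes S: "S \<in> sets lebesgue"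
    and der: "\<And>x. x \<in> S \<Longrightarrow> (g has_derivative g' x) (at x within S)"
    and inj: "inj_on g S"
    and J: "\<And>x. x \<in> S \<Longrightarrow> J x = fst (g' x (1, 0)) * snd (g' x (0, 1)) - fst (g' x (0, 1)) * snd (g' x (1, 0))"
    and int: "(\<lambda>x. \<bar>J x\<bar> * f (g x)) absolutely_integrable_on S"
  shows "integral (g ` S) f = integral S (\<lambda>x. \<bar>J x\<bar> * f (g x))"
proof -
  let ?S = "vec_of_pair ` S"
  define G where "G = (\<lambda>x. vec_of_pair (g (pair_of_vec x)))"
  define G' where "G' = (\<lambda>x h. vec_of_pair (g' (pair_of_vec x) (pair_of_vec h)))"
  \<comment> \<open>The formula on \<open>real^2\<close> is for vector-valued integrands, so
    \<open>f\<close> is wrapped in dimension one.\<close>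
  define F where "F = (\<lambda>x. vec (f (pair_of_vec x)) :: real^1)"
  have S': "?S \<in> sets lebesgue"
    by (intro differentiable_image_in_sets_lebesgue S linear_imp_differentiable_on)
       (auto simp: bounded_linear_vec_of_pair bounded_linear.linear)
  have D': "(G has_derivative G' x) (at x within ?S)" if "x \<in> ?S" for x
  proof -
    have x: "pair_of_vec x \<in> S" and im: "pair_of_vec ` ?S = S"
      using that by (auto simp: image_image)
    have "((\<lambda>x. g (pair_of_vec x)) has_derivative (\<lambda>h. g' (pair_of_vec x) (pair_of_vec h))) (at x within ?S)"
      using has_derivative_compose[of pair_of_vec pair_of_vec x ?S g "g' (pair_of_vec x)"]
        has_derivative_in_compose[of pair_of_vec pair_of_vec x ?S g "g' (pair_of_vec x)"]
        der[OF x] im bounded_linear_imp_has_derivative[OF bounded_linear_pair_of_vec]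
      by auto
    then show ?thesis
      unfolding G_def G'_def
      by (rule bounded_linear.has_derivative[OF bounded_linear_vec_of_pair])
  qed
  have inj': "inj_on G ?S"
    using inj by (auto simp: inj_on_def G_def) (metis vec_of_pair_inverse)
  have ax: "pair_of_vec (axis 1 1) = (1, 0)" "pair_of_vec (axis 2 1) = (0, 1)"
    by (auto simp: pair_of_vec_def axis_def)
  have det: "det (matrix (G' x)) = J (pair_of_vec x)" if "x \<in> ?S" for x
    using that by (auto simp: det_2 matrix_def G'_def ax J)
  have GS: "G ` ?S = vec_of_pair ` g ` S"
    by (auto simp: G_def image_image)
  have int': "(\<lambda>x. \<bar>det (matrix (G' x))\<bar> *\<^sub>R F (G x)) absolutely_integrable_on ?S"
  proof -
    have "(\<lambda>x. (\<bar>J (pair_of_vec x)\<bar> * f (g (pair_of_vec x)))) absolutely_integrable_on ?S"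
      using int unfolding absolutely_integrable_on_def
      by (simp add: integrable_pair_of_vec_iff[of "\<lambda>x. \<bar>J x\<bar> * f (g x)"]
          integrable_pair_of_vec_iff[of "\<lambda>x. norm (\<bar>J x\<bar> * f (g x))", simplified])
    \<comment> \<open>The exceptional set is empty: the spike lemma serves to rewrite the integrand
      on \<open>?S\<close>, where \<open>det\<close> applies.\<close>
    then have "(\<lambda>x. \<bar>det (matrix (G' x))\<bar> * f (g (pair_of_vec x))) absolutely_integrable_on ?S"
      by (subst (asm) absolutely_integrable_spike_eq[of "{}", symmetric]) (auto simp: det)
    then show ?thesis
      by (simp add: absolutely_integrable_on_1_iff F_def G_def)
  qed
  have "integral (G ` ?S) F = integral ?S (\<lambda>x. \<bar>det (matrix (G' x))\<bar> *\<^sub>R F (G x))"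
    by (rule integral_change_of_variables[OF S' D' inj']) (use int' in auto)
  moreover have "integral (G ` ?S) F $ 1 = integral (g ` S) f"
  proof -
    have "F integrable_on (G ` ?S)"
      using has_absolute_integral_change_of_variables[OF S' D' inj', of F] int'
      using set_lebesgue_integral_eq_integral(1) by blast
    then have "integral (G ` ?S) F $ 1 = integral (G ` ?S) (\<lambda>x. f (pair_of_vec x))"
      by (simp add: integral_on_1_eq F_def)
    then show ?thesis by (simp add: GS integral_pair_of_vec)
  qed
  moreover have "integral ?S (\<lambda>x. \<bar>det (matrix (G' x))\<bar> *\<^sub>R F (G x)) $ 1 = integral S (\<lambda>x. \<bar>J x\<bar> * f (g x))"
  proof -
    have "integral ?S (\<lambda>x. \<bar>det (matrix (G' x))\<bar> *\<^sub>R F (G x)) $ 1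
        = integral ?S (\<lambda>x. \<bar>det (matrix (G' x))\<bar> * f (g (pair_of_vec x)))"
      by (simp add: integral_on_1_eq F_def G_def)
    also have "\<dots> = integral ?S (\<lambda>x. \<bar>J (pair_of_vec x)\<bar> * f (g (pair_of_vec x)))"
      by (rule integral_cong) (simp add: det)
    finally show ?thesis
      by (simp add: integral_pair_of_vec[of _ "\<lambda>x. \<bar>J x\<bar> * f (g x)"])
  qed
  ultimately show ?thesis by metis
qed

section \<open>Geometry of the corner regions\<close>

definition lam :: "real \<Rightarrow> real" where
  "lam a = a\<^sup>2 / (1 + a\<^sup>2)"

lemma aa_lam: "0 < a \<Longrightarrow> aa (lam a) = a"
proof -
  assume "0 < a"
  have n: "1 + a\<^sup>2 \<noteq> 0" by (smt (verit) zero_le_power2)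
  then have "lam a / (1 - lam a) = a\<^sup>2"
    by (simp add: lam_def divide_simps)
  then show ?thesis using \<open>0 < a\<close> by (simp add: aa_def)
qed

lemma lam_aa: "0 < l \<Longrightarrow> l < 1 \<Longrightarrow> lam (aa l) = l"
  by (simp add: aa_def lam_def divide_simps)

lemma lam_strict_mono: "0 \<le> a \<Longrightarrow> a < b \<Longrightarrow> lam a < lam b"
proof -
  assume "0 \<le> a" "a < b"
  then have "a\<^sup>2 < b\<^sup>2" by (simp add: power_strict_mono)
  moreover have "1 + a\<^sup>2 > 0" "1 + b\<^sup>2 > 0" by (smt (verit) zero_le_power2)+
  ultimately show ?thesis by (simp add: lam_def divide_simps algebra_simps)
qed

lemma lam_less_iff: "0 \<le> a \<Longrightarrow> 0 \<le> b \<Longrightarrow> lam a < lam b \<longleftrightarrow> a < b"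
  by (metis lam_strict_mono less_asym less_linear)

lemma lam_le_iff: "0 \<le> a \<Longrightarrow> 0 \<le> b \<Longrightarrow> lam a \<le> lam b \<longleftrightarrow> a \<le> b"
  by (meson lam_less_iff linorder_not_le)

text \<open>The endpoints 1/2 and 4/5 correspond to a = 1 and a = 2; the sign estimates on the
  corners rest on 1 < a < 2.\<close>

lemma aa_bounds:
  assumes "1/2 < l" "l < 4/5"
  shows "1 < aa l" "aa l < 2"
proof -
  have "1 < l / (1 - l)" "l / (1 - l) < 4" using assms by (simp_all add: divide_simps)
  moreover have "sqrt 4 = 2" by (simp add: real_sqrt_eq_iff)
  ultimately show "1 < aa l" "aa l < 2"
    unfolding aa_def by (simp, metis real_sqrt_less_mono)
qed

lemma aa_strict_mono: "0 < l \<Longrightarrow> l < l' \<Longrightarrow> l' < 1 \<Longrightarrow> aa l < aa l'"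
  unfolding aa_def by (intro real_sqrt_less_mono) (simp add: divide_simps algebra_simps)

lemma aa_mono: "0 < l \<Longrightarrow> l \<le> l' \<Longrightarrow> l' < 1 \<Longrightarrow> aa l \<le> aa l'"
  using aa_strict_mono by (cases "l = l'") (auto simp: less_eq_real_def)

text \<open>A sign \<open>\<tau>\<close> selects one of the sides of slope \<open>1/a\<close>, with \<open>-1\<close> for \<open>CA\<close> and \<open>1\<close> for
  \<open>BD\<close>; a sign \<open>\<upsilon>\<close> selects one of the sides of slope \<open>-1/a\<close>, with \<open>-1\<close> for \<open>AB\<close> and \<open>1\<close> for
  \<open>DC\<close>.\<close>

definition fU :: "real \<Rightarrow> real \<Rightarrow> real \<times> real \<Rightarrow> real" where
  "fU \<tau> k p = snd p + 1 + 2 * \<tau> - \<tau> * k - (fst p + 1) / k"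

definition fL :: "real \<Rightarrow> real \<Rightarrow> real \<times> real \<Rightarrow> real" where
  "fL \<upsilon> k p = snd p + \<upsilon> - \<upsilon> * k + (fst p + 1) / k"

text \<open>Since x/a = (x + 1)/a - 1/a, each strip inequality is a sign condition on an affine form
  that vanishes on one of the side lines.\<close>

lemma PP_iff:
  "p \<in> PP l \<longleftrightarrow> fU (-1) (aa l) p < 0 \<and> 0 < fU 1 (aa l) p \<and> 0 < fL (-1) (aa l) p \<and> fL 1 (aa l) p < 0"
  by (cases p) (auto simp: PP_def fU_def fL_def add_divide_distrib algebra_simps)

text \<open>In each pair the side bounding the chosen corner comes first and the opposite side
  second, so one argument serves all four corners.\<close>

lemma PP_sign_iff:
  assumes "\<tau> \<in> {-1, 1}" "\<upsilon> \<in> {-1, 1}"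
  shows "p \<in> PP l \<longleftrightarrow> 0 < \<tau> * fU \<tau> (aa l) p \<and> 0 < - \<tau> * fU (-\<tau>) (aa l) p
           \<and> \<upsilon> * fL \<upsilon> (aa l) p < 0 \<and> - \<upsilon> * fL (-\<upsilon>) (aa l) p < 0"
  using assms by (auto simp: PP_iff)

lemma PP_subset_domD:
  assumes "1 < aa l"
  shows "PP l \<subseteq> domD"
proof
  fix p assume "p \<in> PP l"
  obtain x z where p: "p = (x, z)" by (cases p)
  define k where "k = aa l"
  define r where "r = (x + 1) / k"
  have k: "1 < k" using assms by (simp add: k_def)
  then have x: "x = r * k - 1" by (simp add: r_def)
  have i: "z + 1 - 2 + k - r < 0" "0 < z + 3 - k - r" "0 < z - 1 + k + r" "z + 1 - k + r < 0"
    using \<open>p \<in> PP l\<close> by (auto simp: PP_iff p fU_def fL_def k_def r_def)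
  have "0 < r" using i by linarith
  then have "-1 < x" using k by (simp add: x)
  moreover have "-1 < z" "z < 0" using i by linarith+
  moreover have "x < z + 1"
  proof -
    \<comment> \<open>With the weights k + 1 and k - 1 the left sides add up to 2 (x + 1) - 2 z and
      the right sides to 4.\<close>
    have "(k + 1) * (r - z) < (k + 1) * (3 - k)" "(k - 1) * (r + z) < (k - 1) * (k - 1)"
      using k i by (auto intro!: mult_strict_left_mono)
    then show ?thesis by (simp add: x algebra_simps)
  qed
  ultimately show "p \<in> domD" by (simp add: domD_def p)
qed

text \<open>By convexity, the open segment from \<open>p\<close> to an interior point of the
  parallelogram lies in \<open>PP l\<close>, and \<open>p\<close> is its endpoint.\<close>

lemma closure_PP:
  assumes k: "1 < aa l" "aa l < 2"
    and p: "fU (-1) (aa l) p \<le> 0" "0 \<le> fU 1 (aa l) p" "0 \<le> fL (-1) (aa l) p" "fL 1 (aa l) p \<le> 0"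
  shows "p \<in> closure (PP l)"
proof -
  define k where "k = aa l"
  \<comment> \<open>The centre of the parallelogram: the two forms \<open>fU\<close> take the values
    k - 2 and 2 - k there, the two forms \<open>fL\<close> the values k - 1 and 1 - k.\<close>
  define c where "c = ((k - 2) / 2, - 1/2 :: real)"
  define g where "g = (\<lambda>e. p + e *\<^sub>R (c - p))"
  have c: "fU (-1) k c < 0" "0 < fU 1 k c" "0 < fL (-1) k c" "fL 1 k c < 0"
    using k by (auto simp: fU_def fL_def c_def k_def field_simps)
  have U: "fU s k (g e) = (1 - e) * fU s k p + e * fU s k c"
   and L: "fL s k (g e) = (1 - e) * fL s k p + e * fL s k c" for s e
    by (auto simp: fU_def fL_def g_def algebra_simps diff_divide_distrib add_divide_distrib)
  have neg: "(1 - e) * v + e * w < 0" if "v \<le> 0" "w < 0" "0 < e" "e < 1" for e v w :: real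
    by (metis add.commute add_neg_nonpos diff_gt_0_iff_gt less_imp_le mult_nonneg_nonpos mult_pos_neg that)
  have pos: "0 < (1 - e) * v + e * w" if "0 \<le> v" "0 < w" "0 < e" "e < 1" for e v w :: real
    using neg[of "-v" "-w" e] that by simp
  have "g ` {0<..<1} \<subseteq> PP l"
    using c p neg pos by (auto simp: PP_iff U L k_def[symmetric])
  then have "g ` closure {0<..<1} \<subseteq> closure (PP l)"
    by (intro image_closure_subset) (auto simp: g_def closure_subset[THEN subsetD] intro!: continuous_intros)
  then have "g 0 \<in> closure (PP l)"
    by (auto simp: closure_greaterThanLessThan)
  then show ?thesis by (simp add: g_def)
qed

text \<open>\<open>corner_map \<tau> \<upsilon> (a, b)\<close> is the intersection of the line \<open>fU \<tau> a p = 0\<close> with the line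
  \<open>fL \<upsilon> b p = 0\<close>; \<open>cornerX\<close> is \<open>x + 1\<close> there.\<close>

definition cornerX :: "real \<Rightarrow> real \<Rightarrow> real \<times> real \<Rightarrow> real" where
  "cornerX \<tau> \<upsilon> p = fst p * snd p * (1 + 2 * \<tau> - \<upsilon> + \<upsilon> * snd p - \<tau> * fst p) / (fst p + snd p)"

definition corner_map :: "real \<Rightarrow> real \<Rightarrow> real \<times> real \<Rightarrow> real \<times> real" where
  "corner_map \<tau> \<upsilon> p = (cornerX \<tau> \<upsilon> p - 1, -1 - 2 * \<tau> + \<tau> * fst p + cornerX \<tau> \<upsilon> p / fst p)"

text \<open>This is the equation that determines \<open>cornerX\<close>: the two lines have equal
  height at the crossing, so z may be read off from either.\<close>

lemma corner_map_snd:
  assumes "0 < a" "0 < b"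
  shows "-1 - 2 * \<tau> + \<tau> * a + cornerX \<tau> \<upsilon> (a, b) / a = -\<upsilon> + \<upsilon> * b - cornerX \<tau> \<upsilon> (a, b) / b"
proof -
  have "a + b > 0" using assms by simp
  then show ?thesis using assms
    by (simp add: cornerX_def divide_simps) (simp add: algebra_simps)
qed

lemma corner_map_eqI:
  assumes "0 < a" "0 < b" "fU \<tau> a p = 0" "fL \<upsilon> b p = 0"
  shows "p = corner_map \<tau> \<upsilon> (a, b)"
proof -
  obtain x z where p: "p = (x, z)" by (cases p)
  have e: "z + 1 + 2 * \<tau> - \<tau> * a - (x + 1) / a = 0" "z + \<upsilon> - \<upsilon> * b + (x + 1) / b = 0"
    using assms by (auto simp: p fU_def fL_def)
  then have "(x + 1) / b + (x + 1) / a = 1 + 2 * \<tau> - \<upsilon> + \<upsilon> * b - \<tau> * a" by linarith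
  moreover have "(x + 1) / b + (x + 1) / a = (x + 1) * (a + b) / (a * b)"
    using assms by (simp add: divide_simps) (simp add: algebra_simps)
  ultimately have "(x + 1) * (a + b) = (1 + 2 * \<tau> - \<upsilon> + \<upsilon> * b - \<tau> * a) * (a * b)"
    using assms by (simp add: divide_simps)
  then have "x + 1 = cornerX \<tau> \<upsilon> (a, b)"
    using assms by (simp add: cornerX_def divide_simps mult.commute)
  then show ?thesis using e by (simp add: p corner_map_def)
qed

text \<open>Write \<open>cornerX\<close> as b (a e) / (a + b) with e the bracket in its numerator;
  the upper bound then amounts to a e \<le> a + b.\<close>

lemma cornerX_bounds:
  assumes "\<tau> \<in> {-1, 1}" "\<upsilon> \<in> {-1, 1}" "1 \<le> b" "b \<le> a" "a \<le> 2"
  shows "0 \<le> cornerX \<tau> \<upsilon> (a, b)" "cornerX \<tau> \<upsilon> (a, b) \<le> b"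
proof -
  define e where "e = 1 + 2 * \<tau> - \<upsilon> + \<upsilon> * b - \<tau> * a"
  have "0 \<le> e" using assms by (auto simp: e_def)
  then show "0 \<le> cornerX \<tau> \<upsilon> (a, b)" using assms by (simp add: cornerX_def e_def)
  \<comment> \<open>Products of nonnegative factors, chosen so that in each of the four sign cases a
    e \<le> a + b is a linear consequence of them.\<close>
  have "0 \<le> (2 - a) * (a + b)" "0 \<le> (2 - a) * a" "0 \<le> (a - 1) * (a - b)"
     "0 \<le> (b - 1) * (a + 1)" "0 \<le> (a - 1) * (a - 1)" "0 \<le> a * (b - 1)"
    using assms by auto
  note n = this[unfolded left_diff_distrib right_diff_distrib distrib_left distrib_right]
  have "a * e = a + 2 * (a * \<tau>) - a * \<upsilon> + \<upsilon> * (a * b) - \<tau> * (a * a)"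
    by (simp add: e_def algebra_simps)
  then have "a * e \<le> a + b"
    using assms(1,2) n assms(3-5) by (elim insertE emptyE; hypsubst; linarith)
  then have "b * (a * e) \<le> b * (a + b)" using assms by (intro mult_left_mono) auto
  moreover have "cornerX \<tau> \<upsilon> (a, b) = b * (a * e) / (a + b)"
    by (simp add: cornerX_def e_def)
  ultimately show "cornerX \<tau> \<upsilon> (a, b) \<le> b" using assms
    by (simp add: divide_le_eq)
qed

text \<open>The point lies on the line with parameter a, so the form vanishes at k = a and a - k
  splits off. On the opposite side the constant 4 - 2 a is positive for a < 2.\<close>

lemma fU_corner_map:
  assumes "0 < a" "0 < k" "\<tau> \<in> {-1, 1}"
  shows "\<tau> * fU \<tau> k (corner_map \<tau> \<upsilon> (a, b)) = (a - k) * (1 - \<tau> * cornerX \<tau> \<upsilon> (a, b) / (a * k))"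
    and "- \<tau> * fU (-\<tau>) k (corner_map \<tau> \<upsilon> (a, b))
           = (4 - 2 * a) + (a - k) * (1 + \<tau> * cornerX \<tau> \<upsilon> (a, b) / (a * k))"
  using assms by (auto simp: fU_def corner_map_def field_simps)

text \<open>The same factorization at k = b; on the opposite side the constant 2 - 2 b is negative
  for b > 1.\<close>

lemma fL_corner_map:
  assumes "0 < a" "0 < b" "0 < k" "\<upsilon> \<in> {-1, 1}"
  shows "\<upsilon> * fL \<upsilon> k (corner_map \<tau> \<upsilon> (a, b)) = (b - k) * (1 + \<upsilon> * cornerX \<tau> \<upsilon> (a, b) / (b * k))"
    and "- \<upsilon> * fL (-\<upsilon>) k (corner_map \<tau> \<upsilon> (a, b))
           = (2 - 2 * b) - (k - b) * (1 - \<upsilon> * cornerX \<tau> \<upsilon> (a, b) / (b * k))"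
proof -
  have "corner_map \<tau> \<upsilon> (a, b) = (cornerX \<tau> \<upsilon> (a, b) - 1, -\<upsilon> + \<upsilon> * b - cornerX \<tau> \<upsilon> (a, b) / b)"
    using corner_map_snd[OF assms(1,2), of \<tau> \<upsilon>] by (simp add: corner_map_def)
  then show "\<upsilon> * fL \<upsilon> k (corner_map \<tau> \<upsilon> (a, b)) = (b - k) * (1 + \<upsilon> * cornerX \<tau> \<upsilon> (a, b) / (b * k))"
    and "- \<upsilon> * fL (-\<upsilon>) k (corner_map \<tau> \<upsilon> (a, b))
           = (2 - 2 * b) - (k - b) * (1 - \<upsilon> * cornerX \<tau> \<upsilon> (a, b) / (b * k))"
    using assms by (auto simp: fL_def field_simps)
qed

text \<open>The chain \<open>cornerX\<close> \<le> b < b k \<le> a k puts both quotients in [0, 1).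
  These are the cofactors in the factorizations above, whose signs are therefore those of a - k and
  b - k.\<close>

lemma corner_factors_pos:
  assumes "\<tau> \<in> {-1, 1}" "\<upsilon> \<in> {-1, 1}" "1 < b" "b \<le> a" "a < 2" "1 < k" "s \<in> {-1, 1}"
  shows "0 < 1 + s * cornerX \<tau> \<upsilon> (a, b) / (a * k)" "0 < 1 + s * cornerX \<tau> \<upsilon> (a, b) / (b * k)"
proof -
  have X: "0 \<le> cornerX \<tau> \<upsilon> (a, b)" "cornerX \<tau> \<upsilon> (a, b) \<le> b"
    using cornerX_bounds[of \<tau> \<upsilon> b a] assms by auto
  have "b * 1 < b * k" "b * k \<le> a * k" using assms by (auto intro!: mult_strict_left_mono mult_right_mono)
  then have *: "cornerX \<tau> \<upsilon> (a, b) < b * k" "cornerX \<tau> \<upsilon> (a, b) < a * k" "0 < b * k" "0 < a * k"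
    using X assms by linarith+
  then have "cornerX \<tau> \<upsilon> (a, b) / (b * k) < 1" "cornerX \<tau> \<upsilon> (a, b) / (a * k) < 1"
    by (simp_all add: divide_simps)
  moreover have "0 \<le> cornerX \<tau> \<upsilon> (a, b) / (b * k)" "0 \<le> cornerX \<tau> \<upsilon> (a, b) / (a * k)"
    using X * by (simp_all add: divide_simps)
  ultimately show "0 < 1 + s * cornerX \<tau> \<upsilon> (a, b) / (a * k)" "0 < 1 + s * cornerX \<tau> \<upsilon> (a, b) / (b * k)"
    using assms(7) by (auto simp del: times_divide_eq_right simp: times_divide_eq_right[symmetric])
qed

text \<open>The two sides bounding the corner yield exactly k < a and b < k, and the conditions from
  the opposite sides follow from these. This determines the range of integration in
  \<open>psi\<close>.\<close>

lemma corner_map_mem_PP_iff: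
  assumes s: "\<tau> \<in> {-1, 1}" "\<upsilon> \<in> {-1, 1}" and ab: "1 < b" "b \<le> a" "a < 2" and k: "1 < aa l"
  shows "corner_map \<tau> \<upsilon> (a, b) \<in> PP l \<longleftrightarrow> b < aa l \<and> aa l < a"
proof -
  define k where "k = aa l"
  have k1: "1 < k" using k by (simp add: k_def)
  let ?p = "corner_map \<tau> \<upsilon> (a, b)" and ?X = "cornerX \<tau> \<upsilon> (a, b)"
  have f: "0 < 1 + s * ?X / (a * k)" "0 < 1 + s * ?X / (b * k)" if "s \<in> {-1,1}" for s
    using corner_factors_pos[OF s ab k1 that] by auto
  have f': "0 < 1 - \<tau> * ?X / (a * k)" "0 < 1 - \<upsilon> * ?X / (b * k)"
    using f[of "-\<tau>"] f[of "-\<upsilon>"] s by auto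
  have own: "0 < \<tau> * fU \<tau> k ?p \<longleftrightarrow> k < a" "\<upsilon> * fL \<upsilon> k ?p < 0 \<longleftrightarrow> b < k"
    using s ab k1 f' f[OF s(2)] by (auto simp: fU_corner_map(1) fL_corner_map(1) zero_less_mult_iff mult_less_0_iff)
  have other: "0 < - \<tau> * fU (-\<tau>) k ?p" "- \<upsilon> * fL (-\<upsilon>) k ?p < 0" if "b < k" "k < a"
  proof -
    have "0 < (a - k) * (1 + \<tau> * ?X / (a * k))" "0 < (k - b) * (1 - \<upsilon> * ?X / (b * k))"
      using that f' f[OF s(1)] by (auto intro!: mult_pos_pos)
    moreover have "0 < a" "0 < b" "0 < k" using ab k1 by auto
    ultimately show "0 < - \<tau> * fU (-\<tau>) k ?p" "- \<upsilon> * fL (-\<upsilon>) k ?p < 0"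
      using ab s by (simp_all only: fU_corner_map(2) fL_corner_map(2))
  qed
  show ?thesis
    unfolding PP_sign_iff[OF s] k_def[symmetric] using own other by blast
qed

text \<open>The same sign analysis with weak inequalities; it is wanted at k = a and k = b, where
  the point lies on the side itself.\<close>

lemma corner_map_mem_closure_PP:
  assumes s: "\<tau> \<in> {-1, 1}" "\<upsilon> \<in> {-1, 1}" and ab: "1 < b" "b \<le> a" "a < 2" and k: "b \<le> aa l" "aa l \<le> a"
  shows "corner_map \<tau> \<upsilon> (a, b) \<in> closure (PP l)"
proof -
  define k where "k = aa l"
  have k1: "1 < k" "b \<le> k" "k \<le> a" using k ab by (simp_all add: k_def)
  have pos: "0 < a" "0 < b" "0 < k" using ab k1 by auto
  let ?p = "corner_map \<tau> \<upsilon> (a, b)" and ?X = "cornerX \<tau> \<upsilon> (a, b)"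
  have f: "0 < 1 + s * ?X / (a * k)" "0 < 1 + s * ?X / (b * k)" if "s \<in> {-1,1}" for s
    using corner_factors_pos[OF s ab k1(1) that] by auto
  have f': "0 < 1 - \<tau> * ?X / (a * k)" "0 < 1 - \<upsilon> * ?X / (b * k)"
    using f[of "-\<tau>"] f[of "-\<upsilon>"] s by auto
  have "0 \<le> (a - k) * (1 + \<tau> * ?X / (a * k))" "0 \<le> (k - b) * (1 - \<upsilon> * ?X / (b * k))"
      "0 \<le> (a - k) * (1 - \<tau> * ?X / (a * k))" "(b - k) * (1 + \<upsilon> * ?X / (b * k)) \<le> 0"
    using k1 f' f[OF s(1)] f[OF s(2)] by (auto intro!: mult_nonneg_nonneg simp: mult_le_0_iff)
  then have "0 \<le> \<tau> * fU \<tau> k ?p" "0 \<le> - \<tau> * fU (-\<tau>) k ?p" "\<upsilon> * fL \<upsilon> k ?p \<le> 0" "- \<upsilon> * fL (-\<upsilon>) k ?p \<le> 0"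
    using ab s pos by (simp_all only: fU_corner_map fL_corner_map)
  then show ?thesis
    using s k1 ab by (intro closure_PP) (auto simp: k_def)
qed

section \<open>The corners between the images of an open and a closed parameter triangle\<close>

definition sideU :: "real \<Rightarrow> real \<Rightarrow> (real \<times> real) set" where
  "sideU \<tau> l = closure (PP l) \<inter> {p. fU \<tau> (aa l) p = 0}"

definition sideL :: "real \<Rightarrow> real \<Rightarrow> (real \<times> real) set" where
  "sideL \<upsilon> l = closure (PP l) \<inter> {p. fL \<upsilon> (aa l) p = 0}"

definition corner :: "real \<Rightarrow> real \<Rightarrow> real \<Rightarrow> real \<Rightarrow> (real \<times> real) set" where
  "corner \<tau> \<upsilon> ls lss = interior ((\<Union>l\<in>{ls..lss}. sideU \<tau> l) \<inter> (\<Union>l\<in>{ls..lss}. sideL \<upsilon> l))"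

lemma sides_eq:
  "sideCA = sideU (-1)" "sideBD = sideU 1" "sideAB = sideL (-1)" "sideDC = sideL 1"
  by (auto simp: fun_eq_iff sideU_def sideL_def sideCA_def sideBD_def sideAB_def sideDC_def
      fU_def fL_def add_divide_distrib)

lemma corners_eq:
  "corner1 = corner (-1) 1" "corner2 = corner (-1) (-1)" "corner3 = corner 1 (-1)" "corner4 = corner 1 1"
  by (auto simp: fun_eq_iff corner_def corner1_def corner2_def corner3_def corner4_def
      SigmaCA_def SigmaBD_def SigmaAB_def SigmaDC_def sides_eq Int_commute)

definition tri :: "real \<Rightarrow> real \<Rightarrow> (real \<times> real) set" where
  "tri a0 a1 = {p. a0 < snd p \<and> snd p < fst p \<and> fst p < a1}"

definition ctri :: "real \<Rightarrow> real \<Rightarrow> (real \<times> real) set" where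
  "ctri a0 a1 = {p. a0 \<le> snd p \<and> snd p \<le> fst p \<and> fst p \<le> a1}"

text \<open>A point on the side with parameter a lies in the closure of the corresponding P, hence
  weakly satisfies its inequality for the \<open>\<upsilon>\<close> side; by
  \<open>fL_corner_map\<close> at k = a this forces b \<le> a.\<close>

lemma sides_subset_corner_map:
  assumes s: "\<tau> \<in> {-1, 1}" "\<upsilon> \<in> {-1, 1}" and l: "1/2 < ls" "ls < lss" "lss < 4/5"
  shows "(\<Union>l\<in>{ls..lss}. sideU \<tau> l) \<inter> (\<Union>l\<in>{ls..lss}. sideL \<upsilon> l)
           \<subseteq> corner_map \<tau> \<upsilon> ` ctri (aa ls) (aa lss)"
proof
  fix p assume "p \<in> (\<Union>l\<in>{ls..lss}. sideU \<tau> l) \<inter> (\<Union>l\<in>{ls..lss}. sideL \<upsilon> l)"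
  then obtain m m' where m: "m \<in> {ls..lss}" "m' \<in> {ls..lss}" "p \<in> sideU \<tau> m" "p \<in> sideL \<upsilon> m'"
    by blast
  define a b where "a = aa m" and "b = aa m'"
  have ab: "1 < a" "a < 2" "1 < b" "b < 2"
    using aa_bounds[of m] aa_bounds[of m'] m l by (auto simp: a_def b_def)
  have p: "p = corner_map \<tau> \<upsilon> (a, b)"
    using m ab by (intro corner_map_eqI) (auto simp: sideU_def sideL_def a_def b_def)
  have "PP m \<subseteq> {p. \<upsilon> * fL \<upsilon> a p \<le> 0}"
    using s(2) by (auto simp: PP_iff a_def)
  moreover have "closed {p. \<upsilon> * fL \<upsilon> a p \<le> 0}"
    unfolding fL_def using ab by (intro closed_Collect_le continuous_intros) auto
  ultimately have "closure (PP m) \<subseteq> {p. \<upsilon> * fL \<upsilon> a p \<le> 0}"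
    by (rule closure_minimal)
  then have "\<upsilon> * fL \<upsilon> a p \<le> 0" using m by (auto simp: sideU_def)
  then have "(b - a) * (1 + \<upsilon> * cornerX \<tau> \<upsilon> (a, b) / (b * a)) \<le> 0"
    using fL_corner_map(1)[of a b a \<upsilon> \<tau>] ab s by (simp add: p)
  \<comment> \<open>Here b \<le> a is still to be shown, so \<open>corner_factors_pos\<close> does
    not apply; cancelling a b in \<open>cornerX\<close> gives the sign directly.\<close>
  moreover have "0 < 1 + \<upsilon> * cornerX \<tau> \<upsilon> (a, b) / (b * a)"
  proof -
    have "cornerX \<tau> \<upsilon> (a, b) / (b * a) = (1 + 2 * \<tau> - \<upsilon> + \<upsilon> * b - \<tau> * a) / (a + b)"
      using ab by (simp add: cornerX_def divide_simps)
    then have "1 + \<upsilon> * cornerX \<tau> \<upsilon> (a, b) / (b * a)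
        = 1 + \<upsilon> * ((1 + 2 * \<tau> - \<upsilon> + \<upsilon> * b - \<tau> * a) / (a + b))"
      by (metis times_divide_eq_right)
    also have "\<dots> > 0" using s ab by (auto simp: divide_simps)
    finally show ?thesis .
  qed
  ultimately have "b \<le> a" by (simp add: mult_le_0_iff)
  moreover have "aa ls \<le> b" "a \<le> aa lss"
    using m l by (auto simp: a_def b_def intro!: aa_mono)
  ultimately show "p \<in> corner_map \<tau> \<upsilon> ` ctri (aa ls) (aa lss)"
    by (auto simp: p ctri_def)
qed

text \<open>The closure lemma at k = a and at k = b puts the point on the sides belonging to
  \<open>lam a\<close> and \<open>lam b\<close>.\<close>

lemma corner_map_subset_sides:
  assumes s: "\<tau> \<in> {-1, 1}" "\<upsilon> \<in> {-1, 1}" and l: "1/2 < ls" "ls < lss" "lss < 4/5"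
  shows "corner_map \<tau> \<upsilon> ` tri (aa ls) (aa lss)
           \<subseteq> (\<Union>l\<in>{ls..lss}. sideU \<tau> l) \<inter> (\<Union>l\<in>{ls..lss}. sideL \<upsilon> l)"
proof -
  have "corner_map \<tau> \<upsilon> (a, b) \<in> sideU \<tau> (lam a) \<inter> sideL \<upsilon> (lam b)"
      "lam a \<in> {ls..lss}" "lam b \<in> {ls..lss}"
    if "aa ls < b" "b < a" "a < aa lss" for a b
  proof -
    have ab: "1 < b" "a < 2" using aa_bounds[of ls] aa_bounds[of lss] l that by auto
    then have pos: "0 < a" "0 < b" using that by auto
    have "fU \<tau> a (corner_map \<tau> \<upsilon> (a, b)) = 0"
      by (simp add: fU_def corner_map_def)
    moreover have "fL \<upsilon> b (corner_map \<tau> \<upsilon> (a, b)) = 0"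
      using corner_map_snd[OF pos, of \<tau> \<upsilon>] by (simp add: fL_def corner_map_def)
    ultimately show "corner_map \<tau> \<upsilon> (a, b) \<in> sideU \<tau> (lam a) \<inter> sideL \<upsilon> (lam b)"
      using corner_map_mem_closure_PP[OF s ab(1) _ ab(2), of "lam a"]
        corner_map_mem_closure_PP[OF s ab(1) _ ab(2), of "lam b"] that pos
      by (auto simp: sideU_def sideL_def aa_lam)
    have "lam (aa ls) < lam b" "lam b < lam a" "lam a < lam (aa lss)"
      using that aa_bounds[of ls] l pos by (auto intro!: lam_strict_mono)
    then show "lam a \<in> {ls..lss}" "lam b \<in> {ls..lss}"
      using l by (auto simp: lam_aa)
  qed
  then show ?thesis by (fastforce simp: tri_def)
qed

section \<open>The side parameters as coordinates\<close>

text \<open>\<open>jU\<close> and \<open>jL\<close> are the reciprocals of \<open>\<partial>a/\<partial>z\<close> and \<open>\<partial>b/\<partial>z\<close> for the parameters \<open>(a, b)\<close> of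
  the two sides through a point, and the Jacobian of \<open>corner_map\<close> is \<open>- kap * jU * jL\<close>.\<close>

definition jU :: "real \<Rightarrow> real \<Rightarrow> real \<times> real \<Rightarrow> real" where
  "jU \<tau> \<upsilon> p = \<tau> - cornerX \<tau> \<upsilon> p / (fst p)\<^sup>2"

definition jL :: "real \<Rightarrow> real \<Rightarrow> real \<times> real \<Rightarrow> real" where
  "jL \<tau> \<upsilon> p = \<upsilon> + cornerX \<tau> \<upsilon> p / (snd p)\<^sup>2"

definition kap :: "real \<times> real \<Rightarrow> real" where
  "kap p = fst p * snd p / (fst p + snd p)"

text \<open>These are factors from \<open>corner_factors_pos\<close>, taken at k = a and k =
  b.\<close>

lemma jU_jL_pos:
  assumes "\<tau> \<in> {-1, 1}" "\<upsilon> \<in> {-1, 1}" "1 < b" "b \<le> a" "a < 2"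
  shows "0 < \<tau> * jU \<tau> \<upsilon> (a, b)" "0 < \<upsilon> * jL \<tau> \<upsilon> (a, b)"
proof -
  have "\<tau> * jU \<tau> \<upsilon> (a, b) = 1 + - \<tau> * cornerX \<tau> \<upsilon> (a, b) / (a * a)"
    "\<upsilon> * jL \<tau> \<upsilon> (a, b) = 1 + \<upsilon> * cornerX \<tau> \<upsilon> (a, b) / (b * b)"
    using assms(1,2) by (auto simp: jU_def jL_def power2_eq_square)
  then show "0 < \<tau> * jU \<tau> \<upsilon> (a, b)" "0 < \<upsilon> * jL \<tau> \<upsilon> (a, b)"
    using corner_factors_pos(1)[OF assms, of a "-\<tau>"] corner_factors_pos(2)[OF assms, of b \<upsilon>] assms
    by auto
qed

text \<open>The line equations \<open>fU \<tau> a p = 0\<close> and \<open>fL \<upsilon> b p = 0\<close> are quadratic in \<open>a\<close> and \<open>b\<close>; on the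
  corners the side parameters are their larger roots.\<close>

definition root_plus :: "real \<Rightarrow> real \<Rightarrow> real" where
  "root_plus s q = (s + sqrt (s\<^sup>2 - 4 * q)) / 2"

text \<open>The roots of y^2 - s y + q with s = a + q/a are a and q/a, and q < a^2 makes a the
  larger one.\<close>

lemma root_plus_eq:
  assumes "0 < a" "q < a\<^sup>2"
  shows "root_plus (a + q / a) q = a" "0 < (a + q / a)\<^sup>2 - 4 * q"
    "sqrt ((a + q / a)\<^sup>2 - 4 * q) = a - q / a"
proof -
  have 1: "(a + q / a)\<^sup>2 - 4 * q = (a - q / a)\<^sup>2"
    using assms by (simp add: power2_eq_square field_simps)
  have 2: "0 < a - q / a" using assms by (simp add: field_simps power2_eq_square)
  then show s: "sqrt ((a + q / a)\<^sup>2 - 4 * q) = a - q / a" "0 < (a + q / a)\<^sup>2 - 4 * q"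
    unfolding 1 by simp_all
  then show "root_plus (a + q / a) q = a" by (simp add: root_plus_def)
qed

text \<open>Implicit differentiation of a + q/a = s gives (1 - q/a^2) a' = s' - q'/a.\<close>

lemma root_plus_deriv:
  assumes "0 < a" "q0 < a\<^sup>2" "s y = a + q0 / a" "q y = q0"
    and s: "(s has_real_derivative s') (at y)" and q: "(q has_real_derivative q') (at y)"
  shows "((\<lambda>y. root_plus (s y) (q y)) has_real_derivative (s' - q' / a) / (1 - q0 / a\<^sup>2)) (at y)"
proof -
  have n: "0 < (s y)\<^sup>2 - 4 * q y" "sqrt ((s y)\<^sup>2 - 4 * q y) = a - q0 / a"
    using root_plus_eq[OF assms(1,2)] assms by auto
  have 2: "0 < a - q0 / a" using assms by (simp add: field_simps power2_eq_square)
  have "((\<lambda>y. (s y)\<^sup>2 - 4 * q y) has_real_derivative (2 * s y * s' - 4 * q')) (at y)"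
    by (auto intro!: derivative_eq_intros s q)
  from DERIV_chain2[OF DERIV_real_sqrt[OF n(1)] this]
  have "((\<lambda>y. root_plus (s y) (q y)) has_real_derivative
      (s' + inverse (sqrt ((s y)\<^sup>2 - 4 * q y)) / 2 * (2 * s y * s' - 4 * q')) / 2) (at y)"
    unfolding root_plus_def by (intro DERIV_cdivide DERIV_add s)
  also have "(s' + inverse (sqrt ((s y)\<^sup>2 - 4 * q y)) / 2 * (2 * s y * s' - 4 * q')) / 2
      = (s' - q' / a) / (1 - q0 / a\<^sup>2)"
  proof -
    \<comment> \<open>The value of the square root; expressing \<open>q0\<close> and
      \<open>s y\<close> through a and d leaves a rational identity.\<close>
    define d where "d = a - q0 / a"
    have q0: "q0 = a * (a - d)" using assms(1) by (simp add: d_def field_simps)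
    have q: "1 - q0 / a\<^sup>2 = d / a" using assms(1) by (simp add: q0 power2_eq_square field_simps)
    have sy: "s y = 2 * a - d" using assms(1,3) by (simp add: d_def)
    have "0 < d" using 2 by (simp add: d_def)
    then show ?thesis using assms(1) unfolding n(2) unfolding d_def[symmetric] q sy
      by (simp add: divide_simps) (simp add: algebra_simps)
  qed
  finally show ?thesis .
qed

text \<open>Multiplying \<open>fU \<tau> k p = 0\<close> by -\<tau> k gives k^2 - (\<tau> (z + 1) +
  2) k + \<tau> (x + 1) = 0 for a sign \<tau>; \<open>lower_param\<close> arises likewise from
  \<open>fL\<close>.\<close>

definition upper_param :: "real \<Rightarrow> real \<times> real \<Rightarrow> real" where
  "upper_param \<tau> p = root_plus (\<tau> * (snd p + 1) + 2) (\<tau> * (fst p + 1))"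

definition lower_param :: "real \<Rightarrow> real \<times> real \<Rightarrow> real" where
  "lower_param \<upsilon> p = root_plus (\<upsilon> * snd p + 1) (- \<upsilon> * (fst p + 1))"

text \<open>Vieta for the two quadratics: the other roots are \<tau> (x + 1)/a and -\<upsilon> (x +
  1)/b, and the strict inequalities make them the smaller ones.\<close>

lemma corner_roots:
  assumes s: "\<tau> \<in> {-1, 1}" "\<upsilon> \<in> {-1, 1}" and ab: "1 < b" "b \<le> a" "a < 2"
    and xz: "corner_map \<tau> \<upsilon> (a, b) = (x, z)"
  shows "\<tau> * (x + 1) < a\<^sup>2" "- \<upsilon> * (x + 1) < b\<^sup>2"
    "\<tau> * (z + 1) + 2 = a + \<tau> * (x + 1) / a" "\<upsilon> * z + 1 = b + (- \<upsilon> * (x + 1)) / b"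
    "x + 1 = cornerX \<tau> \<upsilon> (a, b)"
proof -
  have pos: "0 < a" "0 < b" using ab by auto
  show x: "x + 1 = cornerX \<tau> \<upsilon> (a, b)" using xz by (auto simp: corner_map_def)
  have z: "z = -1 - 2 * \<tau> + \<tau> * a + (x + 1) / a" "z = -\<upsilon> + \<upsilon> * b - (x + 1) / b"
    using xz corner_map_snd[OF pos, of \<tau> \<upsilon>] by (auto simp: corner_map_def)
  show "\<tau> * (x + 1) < a\<^sup>2" "- \<upsilon> * (x + 1) < b\<^sup>2"
  proof -
    have "0 < 1 + - \<tau> * (x + 1) / (a * a)" "0 < 1 + \<upsilon> * (x + 1) / (b * b)"
      using corner_factors_pos(1)[OF s ab, of a "-\<tau>"] corner_factors_pos(2)[OF s ab, of b \<upsilon>] s ab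
      unfolding x by auto
    then show "\<tau> * (x + 1) < a\<^sup>2" "- \<upsilon> * (x + 1) < b\<^sup>2"
      using pos by (simp_all add: power2_eq_square field_simps)
  qed
  show "\<tau> * (z + 1) + 2 = a + \<tau> * (x + 1) / a"
    unfolding z(1) using s pos by (auto simp: field_simps)
  show "\<upsilon> * z + 1 = b + (- \<upsilon> * (x + 1)) / b"
    unfolding z(2) using s pos by (auto simp: field_simps)
qed

text \<open>These explicit left inverses give both the injectivity of \<open>corner_map\<close> and
  a formula for the wave that can be differentiated in x and z.\<close>

lemma params_corner_map:
  assumes s: "\<tau> \<in> {-1, 1}" "\<upsilon> \<in> {-1, 1}" and ab: "1 < b" "b \<le> a" "a < 2"
  shows "upper_param \<tau> (corner_map \<tau> \<upsilon> (a, b)) = a" "lower_param \<upsilon> (corner_map \<tau> \<upsilon> (a, b)) = b"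
proof -
  obtain x z where xz: "corner_map \<tau> \<upsilon> (a, b) = (x, z)" by fastforce
  note r = corner_roots[OF s ab xz]
  show "upper_param \<tau> (corner_map \<tau> \<upsilon> (a, b)) = a"
    unfolding xz upper_param_def using root_plus_eq(1)[OF _ r(1)] r(3) ab by simp
  show "lower_param \<upsilon> (corner_map \<tau> \<upsilon> (a, b)) = b"
    unfolding xz lower_param_def using root_plus_eq(1)[OF _ r(2)] r(4) ab by simp
qed

lemma params_deriv:
  assumes s: "\<tau> \<in> {-1, 1}" "\<upsilon> \<in> {-1, 1}" and ab: "1 < b" "b \<le> a" "a < 2"
    and xz: "corner_map \<tau> \<upsilon> (a, b) = (x, z)"
  shows "((\<lambda>z. upper_param \<tau> (x, z)) has_real_derivative 1 / jU \<tau> \<upsilon> (a, b)) (at z)"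
    and "((\<lambda>x. upper_param \<tau> (x, z)) has_real_derivative - 1 / (a * jU \<tau> \<upsilon> (a, b))) (at x)"
    and "((\<lambda>z. lower_param \<upsilon> (x, z)) has_real_derivative 1 / jL \<tau> \<upsilon> (a, b)) (at z)"
    and "((\<lambda>x. lower_param \<upsilon> (x, z)) has_real_derivative 1 / (b * jL \<tau> \<upsilon> (a, b))) (at x)"
proof -
  note r = corner_roots[OF s ab xz]
  note j = jU_jL_pos[OF s ab]
  have pos: "0 < a" "0 < b" using ab by auto
  have U: "1 - \<tau> * (x + 1) / a\<^sup>2 = \<tau> * jU \<tau> \<upsilon> (a, b)" "1 - (- \<upsilon> * (x + 1)) / b\<^sup>2 = \<upsilon> * jL \<tau> \<upsilon> (a, b)"
    using s pos by (auto simp: jU_def jL_def r(5)[symmetric] field_simps)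
  have "((\<lambda>z. upper_param \<tau> (x, z)) has_real_derivative (\<tau> - 0 / a) / (1 - \<tau> * (x + 1) / a\<^sup>2)) (at z)"
    unfolding upper_param_def fst_conv snd_conv
    by (rule root_plus_deriv[where s = "\<lambda>z. \<tau> * (z + 1) + 2" and q = "\<lambda>z. \<tau> * (x + 1)", OF pos(1) r(1,3) refl]) (auto intro!: derivative_eq_intros)
  then show "((\<lambda>z. upper_param \<tau> (x, z)) has_real_derivative 1 / jU \<tau> \<upsilon> (a, b)) (at z)"
    unfolding U using s by auto
  have "((\<lambda>x. upper_param \<tau> (x, z)) has_real_derivative (0 - \<tau> / a) / (1 - \<tau> * (x + 1) / a\<^sup>2)) (at x)"
    unfolding upper_param_def fst_conv snd_conv
    by (rule root_plus_deriv[where s = "\<lambda>x. \<tau> * (z + 1) + 2" and q = "\<lambda>x. \<tau> * (x + 1)", OF pos(1) r(1,3) refl]) (auto intro!: derivative_eq_intros)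
  then show "((\<lambda>x. upper_param \<tau> (x, z)) has_real_derivative - 1 / (a * jU \<tau> \<upsilon> (a, b))) (at x)"
    unfolding U using s by auto
  have "((\<lambda>z. lower_param \<upsilon> (x, z)) has_real_derivative (\<upsilon> - 0 / b) / (1 - (- \<upsilon> * (x + 1)) / b\<^sup>2)) (at z)"
    unfolding lower_param_def fst_conv snd_conv
    by (rule root_plus_deriv[where s = "\<lambda>z. \<upsilon> * z + 1" and q = "\<lambda>z. - \<upsilon> * (x + 1)", OF pos(2) r(2,4) refl]) (auto intro!: derivative_eq_intros)
  then show "((\<lambda>z. lower_param \<upsilon> (x, z)) has_real_derivative 1 / jL \<tau> \<upsilon> (a, b)) (at z)"
    unfolding U using s by auto
  have "((\<lambda>x. lower_param \<upsilon> (x, z)) has_real_derivative (0 - (- \<upsilon>) / b) / (1 - (- \<upsilon> * (x + 1)) / b\<^sup>2)) (at x)"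
    unfolding lower_param_def fst_conv snd_conv
    by (rule root_plus_deriv[where s = "\<lambda>x. \<upsilon> * z + 1" and q = "\<lambda>x. - \<upsilon> * (x + 1)", OF pos(2) r(2,4) refl]) (auto intro!: derivative_eq_intros)
  then show "((\<lambda>x. lower_param \<upsilon> (x, z)) has_real_derivative 1 / (b * jL \<tau> \<upsilon> (a, b))) (at x)"
    unfolding U using s by auto
qed

section \<open>The derivative and the Jacobian of the corner map\<close>

definition corner_deriv :: "real \<Rightarrow> real \<Rightarrow> real \<times> real \<Rightarrow> real \<times> real \<Rightarrow> real \<times> real" where
  "corner_deriv \<tau> \<upsilon> p h =
    (kap p * (jL \<tau> \<upsilon> p * snd h - jU \<tau> \<upsilon> p * fst h),
     kap p * (jU \<tau> \<upsilon> p / snd p * fst h + jL \<tau> \<upsilon> p / fst p * snd h))"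

text \<open>Differentiating the two line equations gives dz = dx/a + \<open>jU\<close> da = -dx/b +
  \<open>jL\<close> db; solving for dx produces the factor \<open>kap\<close> = 1 / (1/a + 1/b). The
  proof checks this with the quotient rule.\<close>

lemma cornerX_has_derivative:
  assumes "0 < fst p" "0 < snd p"
  shows "(cornerX \<tau> \<upsilon> has_derivative (\<lambda>h. kap p * (jL \<tau> \<upsilon> p * snd h - jU \<tau> \<upsilon> p * fst h))) (at p within S)"
proof -
  obtain a b where p: "p = (a, b)" by (cases p)
  define e where "e = 1 + 2 * \<tau> - \<upsilon> + \<upsilon> * b - \<tau> * a"
  define N' where "N' = (\<lambda>h. (fst h * b + a * snd h) * e + a * b * (\<upsilon> * snd h - \<tau> * fst h))"
  have pos: "0 < a" "0 < b" "0 < a + b" using assms by (auto simp: p)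
  have N: "((\<lambda>p. fst p * snd p * (1 + 2 * \<tau> - \<upsilon> + \<upsilon> * snd p - \<tau> * fst p)) has_derivative N')
      (at p within S)"
    by (auto intro!: derivative_eq_intros simp: N'_def fun_eq_iff p e_def algebra_simps)
  have D: "((\<lambda>p. fst p + snd p) has_derivative (\<lambda>h. fst h + snd h)) (at p within S)"
    by (auto intro!: derivative_eq_intros)
  have "(cornerX \<tau> \<upsilon> has_derivative (\<lambda>h. (N' h * (a + b) - a * b * e * (fst h + snd h)) / ((a + b) * (a + b))))
      (at p within S)"
    using has_derivative_divide'[OF N D] pos unfolding cornerX_def[abs_def] by (simp add: p e_def)
  also have "(\<lambda>h. (N' h * (a + b) - a * b * e * (fst h + snd h)) / ((a + b) * (a + b)))
      = (\<lambda>h. kap p * (jL \<tau> \<upsilon> p * snd h - jU \<tau> \<upsilon> p * fst h))"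
  proof
    fix h :: "real \<times> real"
    have j: "jU \<tau> \<upsilon> p = \<tau> - b * e / (a * (a + b))" "jL \<tau> \<upsilon> p = \<upsilon> + a * e / (b * (a + b))"
      using pos by (simp_all add: jU_def jL_def cornerX_def p e_def power2_eq_square)
    have "kap p * (jL \<tau> \<upsilon> p * snd h - jU \<tau> \<upsilon> p * fst h)
        = (a * b * (\<upsilon> * snd h - \<tau> * fst h) * (a + b) + e * (a * a * snd h + b * b * fst h)) / ((a + b) * (a + b))"
      unfolding j using pos by (simp add: kap_def p divide_simps) (simp add: algebra_simps)
    also have "a * b * (\<upsilon> * snd h - \<tau> * fst h) * (a + b) + e * (a * a * snd h + b * b * fst h)
        = N' h * (a + b) - a * b * e * (fst h + snd h)"
      by (simp add: N'_def algebra_simps)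
    finally show "(N' h * (a + b) - a * b * e * (fst h + snd h)) / ((a + b) * (a + b))
        = kap p * (jL \<tau> \<upsilon> p * snd h - jU \<tau> \<upsilon> p * fst h)" by simp
  qed
  finally show ?thesis .
qed

lemma corner_map_has_derivative:
  assumes "0 < fst p" "0 < snd p"
  shows "(corner_map \<tau> \<upsilon> has_derivative corner_deriv \<tau> \<upsilon> p) (at p within S)"
proof -
  obtain a b where p: "p = (a, b)" by (cases p)
  have pos: "0 < a" "0 < b" "0 < a + b" using assms by (auto simp: p)
  let ?X' = "\<lambda>h. kap p * (jL \<tau> \<upsilon> p * snd h - jU \<tau> \<upsilon> p * fst h)"
  have "(corner_map \<tau> \<upsilon> has_derivative (\<lambda>h. (?X' h - 0,
      0 + \<tau> * fst h + (?X' h * a - cornerX \<tau> \<upsilon> p * fst h) / (a * a)))) (at p within S)"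
    unfolding corner_map_def[abs_def]
    using has_derivative_divide'[OF cornerX_has_derivative[OF assms] has_derivative_fst[OF has_derivative_ident]] pos
    by (intro has_derivative_Pair has_derivative_diff has_derivative_add has_derivative_const
        cornerX_has_derivative assms has_derivative_mult_right has_derivative_fst has_derivative_ident)
       (simp add: p)
  also have "(\<lambda>h. (?X' h - 0, 0 + \<tau> * fst h + (?X' h * a - cornerX \<tau> \<upsilon> p * fst h) / (a * a))) = corner_deriv \<tau> \<upsilon> p"
  proof -
    have "\<tau> * u + (kap p * (L * v - (\<tau> - X / a\<^sup>2) * u) * a - X * u) / (a * a)
        = kap p * ((\<tau> - X / a\<^sup>2) / b * u + L / a * v)" for u v X L
      using pos by (simp add: p kap_def divide_simps power2_eq_square) (simp add: algebra_simps)
    then show ?thesis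
      by (simp add: fun_eq_iff corner_deriv_def jU_def p)
  qed
  finally show ?thesis .
qed

text \<open>Both products share the factor \<open>jU * jL\<close>; what remains is
  -\<open>kap\<close>^2 (1/a + 1/b), and \<open>kap\<close> is the reciprocal of that sum.\<close>

lemma corner_deriv_det:
  assumes "0 < fst p" "0 < snd p"
  shows "fst (corner_deriv \<tau> \<upsilon> p (1, 0)) * snd (corner_deriv \<tau> \<upsilon> p (0, 1))
       - fst (corner_deriv \<tau> \<upsilon> p (0, 1)) * snd (corner_deriv \<tau> \<upsilon> p (1, 0))
       = - (kap p * jU \<tau> \<upsilon> p * jL \<tau> \<upsilon> p)"
proof -
  have "0 < fst p + snd p" using assms by simp
  then have "kap p * (1 / fst p + 1 / snd p) = 1"
    using assms by (simp add: kap_def divide_simps)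
  moreover have "fst (corner_deriv \<tau> \<upsilon> p (1, 0)) * snd (corner_deriv \<tau> \<upsilon> p (0, 1))
       - fst (corner_deriv \<tau> \<upsilon> p (0, 1)) * snd (corner_deriv \<tau> \<upsilon> p (1, 0))
       = - (kap p * jU \<tau> \<upsilon> p * jL \<tau> \<upsilon> p) * (kap p * (1 / fst p + 1 / snd p))"
    by (simp add: corner_deriv_def algebra_simps)
  ultimately show ?thesis by simp
qed

section \<open>The open and the closed parameter triangle\<close>

lemma tri_params:
  assumes "1/2 < ls" "lss < 4/5" "ls < lss" "(a, b) \<in> ctri (aa ls) (aa lss)"
  shows "1 < b" "b \<le> a" "a < 2"
  using assms aa_bounds[of ls] aa_bounds[of lss] by (auto simp: ctri_def)

lemma tri_subset_ctri: "tri a0 a1 \<subseteq> ctri a0 a1"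
  by (auto simp: tri_def ctri_def)

lemma open_tri: "open (tri a0 a1)"
  unfolding tri_def by (intro open_Collect_conj open_Collect_less continuous_intros)

lemma compact_ctri: "compact (ctri a0 a1)"
proof -
  have "closed (ctri a0 a1)"
    unfolding ctri_def by (intro closed_Collect_conj closed_Collect_le continuous_intros)
  moreover have "ctri a0 a1 \<subseteq> cbox (a0, a0) (a1, a1)"
    by (auto simp: ctri_def)
  ultimately show ?thesis
    by (metis bounded_cbox bounded_subset compact_eq_bounded_closed)
qed

lemma negligible_ctri_diff_tri: "negligible (ctri a0 a1 - tri a0 a1)"
proof -
  have "negligible ({p. (0::real, 1::real) \<bullet> p = a0} \<union> {p. (1::real, 0::real) \<bullet> p = a1} \<union> {p. (1::real, -1::real) \<bullet> p = 0})"
    by (intro negligible_Un negligible_hyperplane) (auto simp: zero_prod_def)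
  then show ?thesis
    by (rule negligible_subset) (auto simp: ctri_def tri_def)
qed

section \<open>The wave in the corner regions\<close>

lemma lam_pos: "0 < a \<Longrightarrow> 0 < lam a"
  by (simp add: lam_def divide_pos_pos add_pos_pos)

lemma lam_has_derivative: "(lam has_real_derivative 2 * a / (1 + a\<^sup>2)\<^sup>2) (at a)"
proof -
  have n: "1 + a\<^sup>2 \<noteq> 0" by (smt (verit) zero_le_power2)
  show ?thesis
    unfolding lam_def[abs_def]
    by (rule derivative_eq_intros refl n)+
       (simp add: power2_eq_square algebra_simps)
qed

lemma absolutely_integrable_on_continuous_compact:
  fixes f :: "'a::euclidean_space \<Rightarrow> real"
  assumes "continuous_on S f" "compact S"
  shows "f absolutely_integrable_on S"
proof -
  have "integrable lborel (\<lambda>x. indicator S x *\<^sub>R f x)"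
    using assms by (rule borel_integrable_compact[rotated])
  then show ?thesis
    unfolding set_integrable_def by (subst integrable_completion) (auto dest: borel_measurable_integrable)
qed

locale wave =
  fixes ls lss :: real and \<sigma>0 :: "real \<Rightarrow> real"
  assumes ls: "1/2 < ls" and ls_lss: "ls < lss" and lss: "lss < 4/5"
    and cont: "continuous_on {ls..lss} \<sigma>0"
begin

abbreviation T :: "(real \<times> real) set" where
  "T \<equiv> tri (aa ls) (aa lss)"

abbreviation Tc :: "(real \<times> real) set" where
  "Tc \<equiv> ctri (aa ls) (aa lss)"

lemma Tc_bounds:
  assumes "(a, b) \<in> Tc"
  shows "1 < b" "b \<le> a" "a < 2" "0 < a" "0 < b"
  using tri_params[OF ls lss ls_lss assms] by auto

lemma T_bounds:
  assumes "(a, b) \<in> T"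
  shows "1 < b" "b \<le> a" "a < 2" "0 < a" "0 < b"
  using Tc_bounds[of a b] assms tri_subset_ctri by auto

lemma lam_T:
  assumes "(a, b) \<in> T"
  shows "ls < lam b" "lam b < lam a" "lam a < lss"
proof -
  have "lam (aa ls) = ls" "lam (aa lss) = lss"
    using ls lss ls_lss by (auto intro!: lam_aa)
  moreover have "1 < aa ls" "1 < aa lss"
    using ls lss ls_lss by (auto intro!: aa_bounds)
  ultimately show "ls < lam b" "lam b < lam a" "lam a < lss"
    using assms lam_strict_mono[of "aa ls" b] lam_strict_mono[of b a] lam_strict_mono[of a "aa lss"]
    by (auto simp: tri_def)
qed

section \<open>The stream function and the velocity on a corner\<close>

definition g :: "real \<Rightarrow> real \<Rightarrow> real" where
  "g t l = cos (sqrt l * t) * \<sigma>0 l"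

definition G :: "real \<Rightarrow> real \<Rightarrow> real" where
  "G t y = integral {ls..y} (g t)"

text \<open>The amplitude density with respect to a: the second factor is the derivative of
  \<open>lam\<close>.\<close>

definition m :: "real \<Rightarrow> real" where
  "m a = \<sigma>0 (lam a) * (2 * a / (1 + a\<^sup>2)\<^sup>2)"

definition h :: "real \<Rightarrow> real \<Rightarrow> real" where
  "h t a = cos (sqrt (lam a) * t) * m a"

text \<open>The integral of \<open>h\<close> over time from 0 to t, the frequency being
  \<open>sqrt (lam a)\<close>.\<close>

definition k :: "real \<Rightarrow> real \<Rightarrow> real" where
  "k t a = sin (sqrt (lam a) * t) / sqrt (lam a) * m a"

lemma continuous_on_g: "continuous_on {ls..lss} (g t)"
  unfolding g_def[abs_def] by (intro continuous_intros cont)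

lemma G_lam_has_derivative:
  assumes "0 < a" "ls < lam a" "lam a < lss"
  shows "((\<lambda>a. G t (lam a)) has_real_derivative h t a) (at a)"
proof -
  have "(G t has_real_derivative g t (lam a)) (at (lam a) within {ls..lss})"
    unfolding G_def[abs_def]
    using integral_has_real_derivative[OF continuous_on_g] assms by auto
  then have "(G t has_real_derivative g t (lam a)) (at (lam a))"
    using assms by (simp add: at_within_Icc_at)
  from DERIV_chain2[OF this lam_has_derivative] show ?thesis
    by (simp add: h_def m_def g_def mult.assoc)
qed

text \<open>By \<open>corner_map_mem_PP_iff\<close> and the monotonicity of \<open>lam\<close>,
  \<open>chi x z\<close> is the indicator of the interval from \<open>lam b\<close> to
  \<open>lam a\<close>.\<close>

lemma psi_corner:
  assumes s: "\<tau> \<in> {-1, 1}" "\<upsilon> \<in> {-1, 1}" and ab: "(a, b) \<in> T"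
    and xz: "corner_map \<tau> \<upsilon> (a, b) = (x, z)"
  shows "psi ls lss \<sigma>0 x z t = G t (lam a) - G t (lam b)"
proof -
  note B = T_bounds[OF ab] and L = lam_T[OF ab]
  have chi: "chi x z l = (if l \<in> {lam b<..<lam a} then 1 else 0)" if "l \<in> {ls..lss}" for l
  proof -
    have l: "1 < aa l" "lam (aa l) = l"
      using aa_bounds[of l] lam_aa[of l] ls lss that by auto
    have "(x, z) \<in> PP l \<longleftrightarrow> b < aa l \<and> aa l < a"
      using corner_map_mem_PP_iff[OF s B(1-3) l(1)] xz by simp
    also have "\<dots> \<longleftrightarrow> l \<in> {lam b<..<lam a}"
      using lam_less_iff[of b "aa l"] lam_less_iff[of "aa l" a] l B by auto
    finally show ?thesis
      using PP_subset_domD[OF l(1)] by (auto simp: chi_def)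
  qed
  have "psi ls lss \<sigma>0 x z t = integral {ls..lss} (\<lambda>l. if l \<in> {lam b<..<lam a} then g t l else 0)"
    unfolding psi_def by (rule integral_cong) (simp add: chi g_def)
  also have "\<dots> = integral ({ls..lss} \<inter> {lam b<..<lam a}) (g t)"
    by (simp only: integral_restrict_Int Int_commute)
  also have "{ls..lss} \<inter> {lam b<..<lam a} = {lam b<..<lam a}"
    using L by auto
  also have "integral {lam b<..<lam a} (g t) = integral {lam b..lam a} (g t)"
    by (rule integral_open_interval_real[symmetric])
  also have "\<dots> = G t (lam a) - G t (lam b)"
  proof -
    have "g t integrable_on {ls..lam a}"
      using L by (intro integrable_continuous_real continuous_on_subset[OF continuous_on_g]) auto
    from Henstock_Kurzweil_Integration.integral_combine[OF _ _ this, of "lam b"] L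
    show ?thesis by (simp add: G_def)
  qed
  finally show ?thesis .
qed

lemma inj_on_corner_map:
  assumes s: "\<tau> \<in> {-1, 1}" "\<upsilon> \<in> {-1, 1}"
  shows "inj_on (corner_map \<tau> \<upsilon>) T"
proof (rule inj_onI)
  fix p q assume pq: "p \<in> T" "q \<in> T" "corner_map \<tau> \<upsilon> p = corner_map \<tau> \<upsilon> q"
  obtain a b c d where [simp]: "p = (a, b)" "q = (c, d)" by (cases p; cases q)
  show "p = q"
    using params_corner_map[OF s T_bounds(1-3)[of a b]] params_corner_map[OF s T_bounds(1-3)[of c d]] pq
    by auto
qed

lemma corner_map_differentiable_on: "corner_map \<tau> \<upsilon> differentiable_on Tc"
  unfolding differentiable_on_def differentiable_def
proof (intro ballI exI)
  fix p assume "p \<in> Tc"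
  then show "(corner_map \<tau> \<upsilon> has_derivative corner_deriv \<tau> \<upsilon> p) (at p within Tc)"
    using Tc_bounds[of "fst p" "snd p"] by (intro corner_map_has_derivative) auto
qed

text \<open>Invariance of domain. Openness places the image inside the interior that defines the
  corner, and it allows local differentiation of \<open>psi\<close>.\<close>

lemma open_corner_image:
  assumes "\<tau> \<in> {-1, 1}" "\<upsilon> \<in> {-1, 1}"
  shows "open (corner_map \<tau> \<upsilon> ` T)"
  using differentiable_imp_continuous_on[OF corner_map_differentiable_on]
  by (intro invariance_of_domain inj_on_corner_map open_tri assms)
     (meson continuous_on_subset tri_subset_ctri)

lemma psi_corner_params:
  assumes s: "\<tau> \<in> {-1, 1}" "\<upsilon> \<in> {-1, 1}" and xz: "(x, z) \<in> corner_map \<tau> \<upsilon> ` T"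
  shows "psi ls lss \<sigma>0 x z t = G t (lam (upper_param \<tau> (x, z))) - G t (lam (lower_param \<upsilon> (x, z)))"
proof -
  obtain a b where ab: "(a, b) \<in> T" "corner_map \<tau> \<upsilon> (a, b) = (x, z)" using xz by auto
  show ?thesis
    using psi_corner[OF s ab] params_corner_map[OF s T_bounds(1-3)[OF ab(1)]] ab(2) by simp
qed

lemma psi_derivs_corner:
  assumes s: "\<tau> \<in> {-1, 1}" "\<upsilon> \<in> {-1, 1}" and ab: "(a, b) \<in> T"
    and xz: "corner_map \<tau> \<upsilon> (a, b) = (x, z)"
  shows "psi_z ls lss \<sigma>0 x z t = h t a / jU \<tau> \<upsilon> (a, b) - h t b / jL \<tau> \<upsilon> (a, b)"
    and "psi_x ls lss \<sigma>0 x z t = - (h t a / (a * jU \<tau> \<upsilon> (a, b)) + h t b / (b * jL \<tau> \<upsilon> (a, b)))"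
proof -
  note B = T_bounds[OF ab] and L = lam_T[OF ab]
  let ?W = "corner_map \<tau> \<upsilon> ` T"
  have par: "upper_param \<tau> (x, z) = a" "lower_param \<upsilon> (x, z) = b"
    using params_corner_map[OF s B(1-3)] xz by auto
  have D: "((\<lambda>a. G t (lam a)) has_real_derivative h t a) (at (upper_param \<tau> (x, z)))"
      "((\<lambda>a. G t (lam a)) has_real_derivative h t b) (at (lower_param \<upsilon> (x, z)))"
    unfolding par using B L by (auto intro!: G_lam_has_derivative)
  note d = params_deriv[OF s B(1-3) xz]
  have mem: "(x, z) \<in> ?W" using ab xz by force
  \<comment> \<open>On these open slices \<open>psi\<close> agrees with the formula in the
    parameters, so the derivatives agree as well.\<close>
  have o: "open ((\<lambda>z. (x, z)) -` ?W)" "open ((\<lambda>x. (x, z)) -` ?W)"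
    by (intro open_vimage open_corner_image s continuous_intros)+
  have "((\<lambda>z. G t (lam (upper_param \<tau> (x, z))) - G t (lam (lower_param \<upsilon> (x, z)))) has_real_derivative
      h t a * (1 / jU \<tau> \<upsilon> (a, b)) - h t b * (1 / jL \<tau> \<upsilon> (a, b))) (at z)"
    by (rule DERIV_diff[OF DERIV_chain2[OF D(1) d(1)] DERIV_chain2[OF D(2) d(3)]])
  then have "((\<lambda>z. psi ls lss \<sigma>0 x z t) has_real_derivative
      h t a * (1 / jU \<tau> \<upsilon> (a, b)) - h t b * (1 / jL \<tau> \<upsilon> (a, b))) (at z)"
    by (rule has_field_derivative_transform_within_open[OF _ o(1)])
       (use mem in \<open>auto simp: psi_corner_params[OF s]\<close>)
  from DERIV_imp_deriv[OF this]
  show "psi_z ls lss \<sigma>0 x z t = h t a / jU \<tau> \<upsilon> (a, b) - h t b / jL \<tau> \<upsilon> (a, b)"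
    by (simp add: psi_z_def)
  have "((\<lambda>x. G t (lam (upper_param \<tau> (x, z))) - G t (lam (lower_param \<upsilon> (x, z)))) has_real_derivative
      h t a * (- 1 / (a * jU \<tau> \<upsilon> (a, b))) - h t b * (1 / (b * jL \<tau> \<upsilon> (a, b)))) (at x)"
    by (rule DERIV_diff[OF DERIV_chain2[OF D(1) d(2)] DERIV_chain2[OF D(2) d(4)]])
  then have "((\<lambda>x. psi ls lss \<sigma>0 x z t) has_real_derivative
      h t a * (- 1 / (a * jU \<tau> \<upsilon> (a, b))) - h t b * (1 / (b * jL \<tau> \<upsilon> (a, b)))) (at x)"
    by (rule has_field_derivative_transform_within_open[OF _ o(2)])
       (use mem in \<open>auto simp: psi_corner_params[OF s]\<close>)
  from DERIV_imp_deriv[OF this]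
  show "psi_x ls lss \<sigma>0 x z t = - (h t a / (a * jU \<tau> \<upsilon> (a, b)) + h t b / (b * jL \<tau> \<upsilon> (a, b)))"
    by (simp add: psi_x_def)
qed

lemma vv_corner:
  assumes s: "\<tau> \<in> {-1, 1}" "\<upsilon> \<in> {-1, 1}" and ab: "(a, b) \<in> T"
    and xz: "corner_map \<tau> \<upsilon> (a, b) = (x, z)"
  shows "vv ls lss \<sigma>0 x z t = k t a / jU \<tau> \<upsilon> (a, b) - k t b / jL \<tau> \<upsilon> (a, b)"
proof -
  note B = T_bounds[OF ab]
  define F where "F = (\<lambda>t. k t a / jU \<tau> \<upsilon> (a, b) - k t b / jL \<tau> \<upsilon> (a, b))"
  have kd: "((\<lambda>t. k t c) has_real_derivative h t c) (at t within S)" if "0 < c" for c t S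
  proof -
    have "((\<lambda>t. sin (r * t) / r * M) has_real_derivative cos (r * t) * M) (at t within S)"
      if "r \<noteq> 0" for r M
      using that by (auto intro!: derivative_eq_intros)
    then show ?thesis
      using lam_pos[OF that] by (simp add: k_def h_def)
  qed
  have "(F has_real_derivative psi_z ls lss \<sigma>0 x z t) (at t within S)" for t S
    unfolding F_def psi_derivs_corner(1)[OF assms]
    by (intro DERIV_diff DERIV_cdivide kd B)
  then have int: "((\<lambda>t. psi_z ls lss \<sigma>0 x z t) has_integral F d - F c) {c..d}" if "c \<le> d" for c d
    by (intro fundamental_theorem_of_calculus that) (simp add: has_real_derivative_iff_has_vector_derivative)
  \<comment> \<open>Fixes the constant of integration; the two instances of \<open>int\<close> treat
    t \<ge> 0 and t < 0.\<close>
  have "F 0 = 0" by (simp add: F_def k_def)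
  then show ?thesis
    using int[of 0 t] int[of t 0] unfolding vv_def F_def[symmetric]
    by (auto simp: integral_unique F_def)
qed

section \<open>The energy density in the coordinates (a, b)\<close>

lemma oscillator_energy: "0 < a \<Longrightarrow> (h t a)\<^sup>2 * (1 + 1 / a\<^sup>2) + (k t a)\<^sup>2 = (m a)\<^sup>2 / lam a"
proof -
  assume "0 < a"
  \<comment> \<open>The left side collects the contributions of u and w; it gives the squared cosine
    the amplitude \<open>(m a)\<^sup>2 / lam a\<close> that the squared sine has in v.\<close>
  then have "1 + 1 / a\<^sup>2 = 1 / lam a" by (simp add: lam_def field_simps)
  moreover have "(k t a)\<^sup>2 = (sin (sqrt (lam a) * t))\<^sup>2 * (m a)\<^sup>2 / lam a"
    using lam_pos[OF \<open>0 < a\<close>] by (simp add: k_def power_mult_distrib power_divide)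
  ultimately have "(h t a)\<^sup>2 * (1 + 1 / a\<^sup>2) + (k t a)\<^sup>2
      = (cos (sqrt (lam a) * t))\<^sup>2 * ((m a)\<^sup>2 / lam a) + (sin (sqrt (lam a) * t))\<^sup>2 * ((m a)\<^sup>2 / lam a)"
    by (simp add: h_def power_mult_distrib)
  then show ?thesis by (simp only: distrib_right[symmetric] sin_cos_squared_add2 mult_1)
qed

text \<open>The cross term of the two waves up to the factor -2: u contributes the 1 and w the -1/(a
  b), because x-derivatives of the parameters carry 1/a and 1/b with opposite signs.\<close>

definition interaction :: "real \<Rightarrow> real \<times> real \<Rightarrow> real" where
  "interaction t p = h t (fst p) * h t (snd p) * (1 - 1 / (fst p * snd p)) + k t (fst p) * k t (snd p)"

lemma edens_corner:
  assumes s: "\<tau> \<in> {-1, 1}" "\<upsilon> \<in> {-1, 1}" and ab: "(a, b) \<in> T"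
  shows "edens ls lss \<sigma>0 t (corner_map \<tau> \<upsilon> (a, b))
     = (m a)\<^sup>2 / lam a / (jU \<tau> \<upsilon> (a, b))\<^sup>2 + (m b)\<^sup>2 / lam b / (jL \<tau> \<upsilon> (a, b))\<^sup>2
       - 2 * interaction t (a, b) / (jU \<tau> \<upsilon> (a, b) * jL \<tau> \<upsilon> (a, b))"
proof -
  obtain x z where xz: "corner_map \<tau> \<upsilon> (a, b) = (x, z)" by fastforce
  note B = T_bounds[OF ab]
  have eq: "(- (H / U - H' / L))\<^sup>2 + (K / U - K' / L)\<^sup>2 + (- (H / (a * U) + H' / (b * L)))\<^sup>2
      = (H\<^sup>2 * (1 + 1 / a\<^sup>2) + K\<^sup>2) / U\<^sup>2 + (H'\<^sup>2 * (1 + 1 / b\<^sup>2) + K'\<^sup>2) / L\<^sup>2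
        - 2 * (H * H' * (1 - 1 / (a * b)) + K * K') / (U * L)" for H H' K K' U L
  proof -
    \<comment> \<open>A polynomial identity, used with the quotients by U and L as amplitudes and
      with p = 1/a, q = 1/b.\<close>
    have "(- (A - A'))\<^sup>2 + (B - B')\<^sup>2 + (- (p * A + q * A'))\<^sup>2
      = (A\<^sup>2 * (1 + p\<^sup>2) + B\<^sup>2) + (A'\<^sup>2 * (1 + q\<^sup>2) + B'\<^sup>2)
        - 2 * (A * A' * (1 - p * q) + B * B')" for A A' B B' p q :: real
      by (simp add: power2_eq_square algebra_simps)
    from this[of "H / U" "H' / L" "K / U" "K' / L" "1 / a" "1 / b"] show ?thesis
      by (simp add: power_divide add_divide_distrib diff_divide_distrib algebra_simps)
  qed
  show ?thesis
    unfolding edens_def xz prod.case uu_def ww_def psi_derivs_corner[OF s ab xz] vv_corner[OF s ab xz]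
      eq oscillator_energy[OF B(4)] oscillator_energy[OF B(5)] interaction_def fst_conv snd_conv ..
qed

definition self_energy :: "real \<Rightarrow> real \<Rightarrow> real \<times> real \<Rightarrow> real" where
  "self_energy \<tau> \<upsilon> p = kap p * (\<tau> * \<upsilon>) *
     ((m (fst p))\<^sup>2 / lam (fst p) * (jL \<tau> \<upsilon> p / jU \<tau> \<upsilon> p) + (m (snd p))\<^sup>2 / lam (snd p) * (jU \<tau> \<upsilon> p / jL \<tau> \<upsilon> p))"

text \<open>The Jacobian cancels the denominator \<open>jU * jL\<close> of the interaction term, so
  no trace of the corner remains here.\<close>

definition mutual_energy :: "real \<Rightarrow> real \<times> real \<Rightarrow> real" where
  "mutual_energy t p = - 2 * kap p * interaction t p"

lemma edens_pullback:
  assumes s: "\<tau> \<in> {-1, 1}" "\<upsilon> \<in> {-1, 1}" and p: "p \<in> T"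
  shows "\<bar>- (kap p * jU \<tau> \<upsilon> p * jL \<tau> \<upsilon> p)\<bar> * edens ls lss \<sigma>0 t (corner_map \<tau> \<upsilon> p)
     = self_energy \<tau> \<upsilon> p + \<tau> * \<upsilon> * mutual_energy t p"
proof -
  obtain a b where [simp]: "p = (a, b)" by (cases p)
  note B = T_bounds[OF p[simplified]]
  define U L where "U = jU \<tau> \<upsilon> p" and "L = jL \<tau> \<upsilon> p"
  have UL: "0 < \<tau> * U" "0 < \<upsilon> * L"
    using jU_jL_pos[OF s B(1-3)] by (auto simp: U_def L_def)
  have "0 < kap p" using B by (simp add: kap_def)
  \<comment> \<open>Resolving the absolute value of the Jacobian is the source of the sign \<tau>
    \<upsilon> by which the corners differ.\<close>
  moreover have "\<bar>U\<bar> = \<tau> * U" "\<bar>L\<bar> = \<upsilon> * L" using s UL by auto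
  ultimately have "\<bar>- (kap p * U * L)\<bar> = kap p * (\<tau> * \<upsilon>) * (U * L)"
    by (simp add: abs_mult)
  moreover have "U * L * (A / U\<^sup>2 + B / L\<^sup>2 - 2 * c / (U * L)) = A * (L / U) + B * (U / L) - 2 * c" for A B c
    using UL by (auto simp: power2_eq_square field_simps)
  moreover have "edens ls lss \<sigma>0 t (corner_map \<tau> \<upsilon> p)
      = (m a)\<^sup>2 / lam a / U\<^sup>2 + (m b)\<^sup>2 / lam b / L\<^sup>2 - 2 * interaction t p / (U * L)"
    using edens_corner[OF s p[simplified], of t] by (simp add: U_def L_def)
  ultimately have "\<bar>- (kap p * U * L)\<bar> * edens ls lss \<sigma>0 t (corner_map \<tau> \<upsilon> p)
      = kap p * (\<tau> * \<upsilon>) * ((m a)\<^sup>2 / lam a * (L / U) + (m b)\<^sup>2 / lam b * (U / L) - 2 * interaction t p)"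
    by (simp only: mult.assoc)
  also have "\<dots> = self_energy \<tau> \<upsilon> p + \<tau> * \<upsilon> * mutual_energy t p"
    unfolding self_energy_def mutual_energy_def U_def[symmetric] L_def[symmetric]
    by (simp add: right_diff_distrib)
  finally show ?thesis unfolding U_def L_def .
qed

section \<open>Integrability, and summation over the corners\<close>

lemma continuous_on_m: "continuous_on {aa ls..aa lss} m"
proof -
  have 1: "1 < aa ls" "1 < aa lss" "lam (aa ls) = ls" "lam (aa lss) = lss"
    using ls lss ls_lss by (auto intro!: aa_bounds lam_aa)
  have sub: "lam ` {aa ls..aa lss} \<subseteq> {ls..lss}"
  proof
    fix y assume "y \<in> lam ` {aa ls..aa lss}"
    then show "y \<in> {ls..lss}"
      using 1 lam_le_iff[of "aa ls"] lam_le_iff[of _ "aa lss"] by auto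
  qed
  have n: "1 + a\<^sup>2 \<noteq> 0" for a :: real by (smt (verit) zero_le_power2)
  have "continuous_on {aa ls..aa lss} lam"
    by (meson DERIV_isCont continuous_at_imp_continuous_on lam_has_derivative)
  then show ?thesis
    unfolding m_def[abs_def] using sub n
    by (intro continuous_intros continuous_on_compose2[OF cont]) auto
qed

text \<open>\<open>jU\<close> and \<open>jL\<close> stay nonzero up to the boundary of the triangle,
  so both integrands are continuous on a compact set; integrability on \<open>T\<close>
  follows.\<close>

lemma continuous_on_Tc:
  assumes s: "\<tau> \<in> {-1, 1}" "\<upsilon> \<in> {-1, 1}"
  shows "continuous_on Tc (self_energy \<tau> \<upsilon>)" "continuous_on Tc (mutual_energy t)"
proof -
  have B: "1 < snd p" "snd p \<le> fst p" "fst p < 2" "0 < fst p" "0 < snd p" "0 < fst p + snd p" if "p \<in> Tc" for p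
    using Tc_bounds[of "fst p" "snd p"] that by auto
  have Bn: "fst p \<noteq> 0" "snd p \<noteq> 0" "fst p + snd p \<noteq> 0" "fst p * snd p \<noteq> 0" if "p \<in> Tc" for p
    using B[OF that] by auto
  have J: "jU \<tau> \<upsilon> p \<noteq> 0" "jL \<tau> \<upsilon> p \<noteq> 0" if "p \<in> Tc" for p
    using jU_jL_pos[OF s, of "snd p" "fst p"] B[OF that] by auto
  have lp: "lam (fst p) \<noteq> 0" "lam (snd p) \<noteq> 0" "sqrt (lam (fst p)) \<noteq> 0" "sqrt (lam (snd p)) \<noteq> 0" if "p \<in> Tc" for p
    using lam_pos[OF B(4)[OF that]] lam_pos[OF B(5)[OF that]] by auto
  have m: "continuous_on Tc (\<lambda>p. m (fst p))" "continuous_on Tc (\<lambda>p. m (snd p))"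
    by (rule continuous_on_compose2[OF continuous_on_m], intro continuous_intros, auto simp: ctri_def)+
  have lamc: "continuous_on UNIV lam"
    by (meson DERIV_isCont continuous_at_imp_continuous_on lam_has_derivative)
  have l: "continuous_on Tc (\<lambda>p. lam (fst p))" "continuous_on Tc (\<lambda>p. lam (snd p))"
    by (rule continuous_on_compose2[OF lamc], intro continuous_intros, simp)+
  have X: "continuous_on Tc (cornerX \<tau> \<upsilon>)"
    unfolding cornerX_def[abs_def] using Bn by (intro continuous_intros) auto
  have j: "continuous_on Tc (jU \<tau> \<upsilon>)" "continuous_on Tc (jL \<tau> \<upsilon>)"
    unfolding jU_def[abs_def] jL_def[abs_def] using Bn by (auto intro!: continuous_intros X)
  have kap: "continuous_on Tc kap"
    unfolding kap_def[abs_def] using Bn by (intro continuous_intros) auto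
  show "continuous_on Tc (self_energy \<tau> \<upsilon>)"
    unfolding self_energy_def[abs_def]
    by (intro continuous_intros kap m l j) (use J lp in auto)
  show "continuous_on Tc (mutual_energy t)"
    unfolding mutual_energy_def[abs_def] interaction_def[abs_def] h_def[abs_def] k_def[abs_def]
    by (intro continuous_intros kap m l) (use Bn lp in auto)
qed

lemma absolutely_integrable_T:
  assumes s: "\<tau> \<in> {-1, 1}" "\<upsilon> \<in> {-1, 1}"
  shows "self_energy \<tau> \<upsilon> absolutely_integrable_on T" "mutual_energy t absolutely_integrable_on T"
proof -
  have "T \<in> sets lebesgue" by (simp add: borel_open open_tri)
  then show "self_energy \<tau> \<upsilon> absolutely_integrable_on T" "mutual_energy t absolutely_integrable_on T"
    using absolutely_integrable_on_continuous_compact[OF continuous_on_Tc(1)[OF s] compact_ctri]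
      absolutely_integrable_on_continuous_compact[OF continuous_on_Tc(2)[OF s] compact_ctri]
      set_integrable_subset tri_subset_ctri by blast+
qed

text \<open>The corner lies between the images of \<open>T\<close> and \<open>Tc\<close>, which
  agree up to a null set, so the integral may be taken over the image of \<open>T\<close> and pulled
  back.\<close>

lemma integral_corner:
  assumes s: "\<tau> \<in> {-1, 1}" "\<upsilon> \<in> {-1, 1}"
  shows "integral (corner \<tau> \<upsilon> ls lss) (edens ls lss \<sigma>0 t)
     = integral T (self_energy \<tau> \<upsilon>) + \<tau> * \<upsilon> * integral T (mutual_energy t)"
proof -
  let ?W = "corner_map \<tau> \<upsilon> ` T" and ?e = "edens ls lss \<sigma>0 t"
  let ?J = "\<lambda>p. - (kap p * jU \<tau> \<upsilon> p * jL \<tau> \<upsilon> p)"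
  have sub: "?W \<subseteq> corner \<tau> \<upsilon> ls lss"
    unfolding corner_def
    by (intro interior_maximal corner_map_subset_sides open_corner_image s ls ls_lss lss)
  have "corner \<tau> \<upsilon> ls lss \<subseteq> corner_map \<tau> \<upsilon> ` Tc"
    unfolding corner_def
    using interior_subset sides_subset_corner_map[OF s ls ls_lss lss] by blast
  \<comment> \<open>The excess lies in the image of the three edges, and a differentiable map of the
    plane sends null sets to null sets.\<close>
  then have "corner \<tau> \<upsilon> ls lss - ?W \<subseteq> corner_map \<tau> \<upsilon> ` (Tc - T)"
    by blast
  moreover have "negligible (corner_map \<tau> \<upsilon> ` (Tc - T))"
    by (rule negligible_differentiable_image_negligible)
       (auto intro: negligible_ctri_diff_tri differentiable_on_subset[OF corner_map_differentiable_on])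
  ultimately have neg: "negligible (corner \<tau> \<upsilon> ls lss - ?W)"
    using negligible_subset by blast
  have "integral (corner \<tau> \<upsilon> ls lss) ?e = integral ?W ?e"
    by (rule integral_spike_set)
       (use neg sub in \<open>auto intro: negligible_subset simp: Diff_eq_empty_iff[THEN iffD2]\<close>)
  also have "\<dots> = integral T (\<lambda>p. \<bar>?J p\<bar> * ?e (corner_map \<tau> \<upsilon> p))"
  proof (rule integral_change_of_variables_prod)
    show "T \<in> sets lebesgue" by (simp add: borel_open open_tri)
    show "inj_on (corner_map \<tau> \<upsilon>) T" by (rule inj_on_corner_map[OF s])
    fix p assume "p \<in> T"
    then have p: "0 < fst p" "0 < snd p" using T_bounds[of "fst p" "snd p"] by auto
    show "(corner_map \<tau> \<upsilon> has_derivative corner_deriv \<tau> \<upsilon> p) (at p within T)"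
      by (rule corner_map_has_derivative[OF p])
    show "?J p = fst (corner_deriv \<tau> \<upsilon> p (1, 0)) * snd (corner_deriv \<tau> \<upsilon> p (0, 1))
       - fst (corner_deriv \<tau> \<upsilon> p (0, 1)) * snd (corner_deriv \<tau> \<upsilon> p (1, 0))"
      by (rule corner_deriv_det[OF p, symmetric])
  next
    have "(\<lambda>p. self_energy \<tau> \<upsilon> p + \<tau> * \<upsilon> * mutual_energy t p) absolutely_integrable_on T"
      by (intro set_integral_add set_integrable_mult_right absolutely_integrable_T[OF s])
    \<comment> \<open>Again a spike with empty exceptional set, used to replace the integrand on
      \<open>T\<close> by an equal one.\<close>
    then show "(\<lambda>p. \<bar>?J p\<bar> * ?e (corner_map \<tau> \<upsilon> p)) absolutely_integrable_on T"
      by (rule absolutely_integrable_spike[of _ _ "{}"]) (simp_all only: edens_pullback[OF s] negligible_empty Diff_empty)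
  qed
  also have "\<dots> = integral T (\<lambda>p. self_energy \<tau> \<upsilon> p + \<tau> * \<upsilon> * mutual_energy t p)"
    by (rule integral_cong) (rule edens_pullback[OF s])
  also have "\<dots> = integral T (self_energy \<tau> \<upsilon>) + integral T (\<lambda>p. \<tau> * \<upsilon> * mutual_energy t p)"
    using absolutely_integrable_T[OF s]
    by (intro Henstock_Kurzweil_Integration.integral_add integrable_on_mult_right) (auto dest: set_lebesgue_integral_eq_integral(1))
  finally show ?thesis by simp
qed

text \<open>The coefficients \<tau> \<upsilon> of the common mutual energy sum to zero over the four
  corners, and t is absent from what remains.\<close>

lemma corner_energy_eq:
  "corner_energy ls lss \<sigma>0 t = integral T (self_energy (-1) 1) + integral T (self_energy (-1) (-1))
     + integral T (self_energy 1 (-1)) + integral T (self_energy 1 1)"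
  by (simp add: corner_energy_def corners_eq integral_corner)

end

theorem theorem4p4:
  fixes ls lss :: real and \<sigma>0 \<sigma>0' :: "real \<Rightarrow> real"
  assumes "1/2 < ls" and "ls < lss" and "lss < 4/5"
    and "\<forall>l\<in>{1/2..4/5}. (\<sigma>0 has_real_derivative \<sigma>0' l) (at l within {1/2..4/5})"
    and "continuous_on {1/2..4/5} \<sigma>0'"
  shows "\<forall>t1 t2. corner_energy ls lss \<sigma>0 t1 = corner_energy ls lss \<sigma>0 t2"
proof -
  have "continuous_on {1/2..4/5} \<sigma>0"
    using assms(4) by (intro DERIV_continuous_on) auto
  then have "continuous_on {ls..lss} \<sigma>0"
    by (rule continuous_on_subset) (use assms(1-3) in auto)
  then interpret wave ls lss \<sigma>0
    using assms(1-3) by unfold_locales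
  show ?thesis by (simp add: corner_energy_eq)
qed

end
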